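(* Consider a single nonconforming interface, parameterized by $\eta\in[-1,1]$, with $N^{-}$ SBP blocks on the minus side and $N^{+}$ SBP blocks on the plus side. For each sign, block $k$ ($1\le k\le N^{\pm}$) overlaps the interface over $\beta^{\pm(k-1)}\le\eta\le\beta^{\pm(k)}$, where $-1=\beta^{\pm(0)}<\beta^{\pm(1)}<\dots<\beta^{\pm(N^{\pm})}=1$, and $\Delta^{\pm(k)}=(\beta^{\pm(k)}-\beta^{\pm(k-1)})/2$. For block $k$ on side $\pm$ let $\mathbf{p}^{\pm(k)},\mathbf{v}^{\pm(k)}$ be the pressure and outward normal velocity grid values along its interface edge, $\mathbf{H}^{\pm(k)}$ the diagonal positive definite 1-D SBP norm matrix (for a grid from $-1$ to $1$), $\mathbf{S}_J^{\pm(k)}$ the positive diagonal surface Jacobian matrix, $\mathbf{M}^{\pm(k)}$ the symmetric positive definite mass matrix of the portion of the glue grid from $\beta^{\pm(k-1)}$ to $\beta^{\pm(k)}$, and $\mathbf{P}_{f2g}^{\pm(k)},\mathbf{P}_{g2f}^{\pm(k)}$ projection matrices satisfying $$\Delta^{\pm(k)}(\mathbf{P}_{g2f}^{\pm(k)})^T\mathbf{H}^{\pm(k)}=\mathbf{M}^{\pm(k)}\mathbf{P}_{f2g}^{\pm(k)}.$$ Set $$\bar{\mathbf{p}}^{\pm(k)}=\mathbf{P}_{f2g}^{\pm(k)}\left(\frac{\mathbf{S}_J^{\pm(k)}}{\Delta^{\pm(k)}}\right)^{1/2}\mathbf{p}^{\pm(k)},\qquad \bar{\mathbf{v}}^{\pm(k)}=\mathbf{P}_{f2g}^{\pm(k)}\left(\frac{\mathbf{S}_J^{\pm(k)}}{\Delta^{\pm(k)}}\right)^{1/2}\mathbf{v}^{\pm(k)},$$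 let $\bar{\mathbf{p}}^{\pm}$, $\bar{\mathbf{v}}^{\pm}$ be the vectors obtained by stacking $\bar{\mathbf{p}}^{\pm(1)},\dots,\bar{\mathbf{p}}^{\pm(N^{\pm})}$ and $\bar{\mathbf{v}}^{\pm(1)},\dots,\bar{\mathbf{v}}^{\pm(N^{\pm})}$, and let $$\mathbf{M}=\mathrm{blockdiag}(\mathbf{M}^{-(1)},\dots,\mathbf{M}^{-(N^-)})=\mathrm{blockdiag}(\mathbf{M}^{+(1)},\dots,\mathbf{M}^{+(N^+)})$$ be the mass matrix of the glue grid. Suppose that for each block $k$ on the minus side the values $\mathbf{p}^{*(k)},\mathbf{v}^{*(k)}$ are given by $$\mathbf{p}^{*(k)}-\mathbf{p}^{-(k)}=\left(\frac{\mathbf{S}_J^{-(k)}}{\Delta^{-(k)}}\right)^{-1/2}\mathbf{P}_{g2f}^{-(k)}(\bar{\mathbf{p}}^{*(k)}-\bar{\mathbf{p}}^{-(k)})+\frac12\left[\left(\frac{\mathbf{S}_J^{-(k)}}{\Delta^{-(k)}}\right)^{-1/2}\mathbf{P}_{g2f}^{-(k)}\bar{\mathbf{p}}^{-(k)}-\mathbf{p}^{-(k)}\right],$$ $$\mathbf{v}^{*(k)}-\mathbf{v}^{-(k)}=\left(\frac{\mathbf{S}_J^{-(k)}}{\Delta^{-(k)}}\right)^{-1/2}\mathbf{P}_{g2f}^{-(k)}(\bar{\mathbf{v}}^{*(k)}-\bar{\mathbf{v}}^{-(k)})+\frac12\left[\left(\frac{\mathbf{S}_J^{-(k)}}{\Delta^{-(k)}}\right)^{-1/2}\mathbf{P}_{g2f}^{-(k)}\bar{\mathbf{v}}^{-(k)}-\mathbf{v}^{-(k)}\right],$$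 where $\bar{\mathbf{p}}^{*(k)},\bar{\mathbf{v}}^{*(k)}$ are the portions corresponding to block $k$ of the vectors $\bar{\mathbf{p}}^*,\bar{\mathbf{v}}^*$ defined by $$\bar{\mathbf{p}}^{*}-\bar{\mathbf{p}}^{-}=\tfrac12(\bar{\mathbf{p}}^{+}-\bar{\mathbf{p}}^{-})+\alpha\tfrac{Z}{2}(\bar{\mathbf{v}}^{+}+\bar{\mathbf{v}}^{-}),\qquad \bar{\mathbf{v}}^{*}-\bar{\mathbf{v}}^{-}=-\tfrac12(\bar{\mathbf{v}}^{+}+\bar{\mathbf{v}}^{-})-\alpha\tfrac{1}{2Z}(\bar{\mathbf{p}}^{+}-\bar{\mathbf{p}}^{-}),$$ and that the values for the plus-side blocks are given by the same formulas with the roles of $+$ and $-$ interchanged. Here $\alpha$ is a real parameter and $Z=\sqrt{\rho/\lambda}>0$. Let $\mathcal{D}^{-}$ and $\mathcal{D}^{+}$ be the energy dissipation rates along the two sides of the interface (each the sum over the blocks on that side of the dissipation rates along their interface edges). Then $$\mathcal{D}^{-}+\mathcal{D}^{+}=-\alpha\frac{Z}{2}(\bar{\mathbf{v}}^{-}+\bar{\mathbf{v}}^{+})^{T}\mathbf{M}(\bar{\mathbf{v}}^{-}+\bar{\mathbf{v}}^{+})-\alpha\frac{1}{2Z}(\bar{\mathbf{p}}^{-}-\bar{\mathbf{p}}^{+})^{T}\mathbf{M}(\bar{\mathbf{p}}^{-}-\bar{\mathbf{p}}^{+}),$$ which is non-positive for $\alpha\ge 0$.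
   Context: Model problem: $\rho\,\partial_t v_i+\partial p/\partial x_i=0$ ($i=1,2$), $\partial_t p+\lambda(\partial v_1/\partial x_1+\partial v_2/\partial x_2)=0$ with constants $\rho,\lambda>0$. SBP block: a quadrilateral block is the image of $[-1,1]^2$ under an invertible coordinate transform $x_i=x_i(\xi_1,\xi_2)$ with Jacobian determinant $J>0$. The block carries the $(N_1+1)\times(N_2+1)$ equispaced grid in $[-1,1]^2$; time-dependent grid functions $\mathbf{v}_1,\mathbf{v}_2,\mathbf{p}\in\mathbb{R}^{(N_1+1)(N_2+1)}$ are ordered with the $\xi_2$-index running fastest. $\mathbf{J}$ and $\mathbf{X}_{ij}$ are the diagonal matrices of grid values of $J$ and $\partial\xi_i/\partial x_j$. The 1-D SBP operators are $\mathbf{D}_{N_i}=\mathbf{H}_{N_i}^{-1}\mathbf{Q}_{N_i}$ with $\mathbf{H}_{N_i}$ diagonal positive definite and $\mathbf{Q}_{N_i}+\mathbf{Q}_{N_i}^T=\mathrm{diag}(-1,0,\dots,0,1)$. Put $\mathbf{H}=\mathbf{H}_{N_1}\otimes\mathbf{H}_{N_2}$, $\mathbf{D}_1=\mathbf{D}_{N_1}\otimes\mathbf{I}$, $\mathbf{D}_2=\mathbf{I}\otimes\mathbf{D}_{N_2}$. The semi-discretization on a block is $$\rho\mathbf{J}\frac{d\mathbf{v}_i}{dt}+\mathbf{D}_1\mathbf{J}\mathbf{X}_{1i}\mathbf{p}+\mathbf{D}_2\mathbf{J}\mathbf{X}_{2i}\mathbf{p}=-\mathbf{H}^{-1}\boldsymbol{\mathcal{F}}_{v_i}\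 (i=1,2),\qquad \mathbf{J}\frac{d\mathbf{p}}{dt}+\lambda\sum_{i,j=1}^2\mathbf{J}\mathbf{X}_{ij}\mathbf{D}_i\mathbf{v}_j=-\lambda\mathbf{H}^{-1}\boldsymbol{\mathcal{F}}_p .$$ The edges $K\in\{W,E,S,N\}$ are $\xi_1=-1$, $\xi_1=1$, $\xi_2=-1$, $\xi_2=1$. On the edge $\xi_a=\pm1$, $S_J=J\sqrt{(\partial\xi_a/\partial x_1)^2+(\partial\xi_a/\partial x_2)^2}$ is the surface Jacobian and $n_i=\pm(J/S_J)\,\partial\xi_a/\partial x_i$ are the components of the outward unit normal; $\mathbf{S}_{JK}$, $\mathbf{n}_i^K$ are the diagonal matrices of their values at the grid points of edge $K$. $\mathbf{p}_K$ is the restriction of $\mathbf{p}$ to edge $K$ and $\mathbf{v}_K=\mathbf{n}^K_1\mathbf{v}_{1}|_K+\mathbf{n}^K_2\mathbf{v}_2|_K$. $\mathbf{H}_W=\mathbf{H}_E=\mathbf{H}_{N_2}$, $\mathbf{H}_S=\mathbf{H}_N=\mathbf{H}_{N_1}$. The penalty terms are $\boldsymbol{\mathcal F}_{\bullet}=\mathbf{e}_W\otimes\boldsymbol{\mathcal F}^W_\bullet+\mathbf{e}_E\otimes\boldsymbol{\mathcal F}^E_\bullet+\boldsymbol{\mathcal F}^S_\bullet\otimes\mathbf{e}_S+\boldsymbol{\mathcal F}^N_\bullet\otimes\mathbf{e}_N$ with $\boldsymbol{\mathcal F}^K_{v_i}=\mathbf{H}_K\mathbf{S}_{JK}\mathbf{n}_i^K(\mathbf{p}^*_K-\mathbf{p}_K)$,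 $\boldsymbol{\mathcal F}^K_{p}=\mathbf{H}_K\mathbf{S}_{JK}(\mathbf{v}^*_K-\mathbf{v}_K)$, where $\mathbf{e}_W,\mathbf{e}_S$ are first and $\mathbf{e}_E,\mathbf{e}_N$ last standard basis vectors, and $\mathbf{p}^*_K,\mathbf{v}^*_K$ are vectors prescribed by the boundary or interface treatment. The block energy is $E=\frac{\rho}{2}\mathbf{v}_1^T\mathbf{J}\mathbf{H}\mathbf{v}_1+\frac{\rho}{2}\mathbf{v}_2^T\mathbf{J}\mathbf{H}\mathbf{v}_2+\frac{1}{2\lambda}\mathbf{p}^T\mathbf{J}\mathbf{H}\mathbf{p}$. Energy dissipation rate along edge $K$ (the contribution of that edge to $dE/dt$): $$\mathcal{D}_K=-\mathbf{v}_K^T\mathbf{H}_K\mathbf{S}_{JK}\mathbf{p}_K^*+\mathbf{v}_K^T\mathbf{H}_K\mathbf{S}_{JK}\mathbf{p}_K-(\mathbf{v}_K^* )^T\mathbf{H}_K\mathbf{S}_{JK}\mathbf{p}_K.$$ $\mathcal{D}^{\pm(k)}$ denotes this quantity for the interface edge of block $k$ on side $\pm$, and $\mathcal{D}^{\pm}=\sum_{k=1}^{N^\pm}\mathcal{D}^{\pm(k)}$. Glue grid: a finite-dimensional space of piecewise defined functions of $\eta\in[-1,1]$ whose interval boundaries include all the block end points $\beta^{\pm(k)}$, with linearly independent basis $\boldsymbol\psi(\eta)$ (each basis function supported on one glue interval) and mass matrix $\mathbf{M}=\int\boldsymbol\psi\boldsymbol\psi^T d\eta$; barred vectors are coefficient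 vectors in this basis, partitioned into block portions either according to the minus-side blocks or according to the plus-side blocks. $\mathbf{M}$ is block diagonal with respect to both partitions. *)

theory Defs
  imports "HOL-Analysis.Analysis" "Jordan_Normal_Form.Matrix"
begin

text \<open>Points of the plane and the 2-by-2 Jacobians are \<^typ>\<open>real^2\<close> and \<^typ>\<open>real^2^2\<close> (with
  components written \<open>vec_nth\<close>); grid vectors and matrices, whose sizes vary, are
  \<open>real Matrix.vec\<close> and \<open>real Matrix.mat\<close>, and \<open>$\<close>, \<open>\<bullet>\<close> refer to these.\<close>

no_notation vec_nth (infixl "$" 90)
no_notation inner (infixl "\<bullet>" 70)


section \<open>Matrices\<close>

definition kron :: "real mat \<Rightarrow> real mat \<Rightarrow> real mat" where
  "kron A B = mat (dim_row A * dim_row B) (dim_col A * dim_col B)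
     (\<lambda>(i, j). A $$ (i div dim_row B, j div dim_col B) * B $$ (i mod dim_row B, j mod dim_col B))"

definition kron_vec :: "real vec \<Rightarrow> real vec \<Rightarrow> real vec" where
  "kron_vec u w = vec (dim_vec u * dim_vec w) (\<lambda>i. u $ (i div dim_vec w) * w $ (i mod dim_vec w))"

text \<open>Real power of a diagonal matrix with positive diagonal entries; exponent \<open>-1\<close> gives the
  inverse.\<close>

definition diag_powr :: "real mat \<Rightarrow> real \<Rightarrow> real mat" where
  "diag_powr A r = mat_diag (dim_row A) (\<lambda>i. (A $$ (i, i)) powr r)"

definition stack :: "real vec list \<Rightarrow> real vec" where
  "stack us = foldr (@\<^sub>v) us (0\<^sub>v 0)"


section \<open>SBP blocks\<close>

definition sbp_operator :: "nat \<Rightarrow> real mat \<Rightarrow> real mat \<Rightarrow> bool" where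
  "sbp_operator n H Q \<longleftrightarrow> 1 \<le> n \<and>
     H \<in> carrier_mat (n + 1) (n + 1) \<and> diagonal_mat H \<and> (\<forall>i\<le>n. 0 < H $$ (i, i)) \<and>
     Q \<in> carrier_mat (n + 1) (n + 1) \<and>
     Q + transpose_mat Q = mat_diag (n + 1) (\<lambda>i. if i = 0 then -1 else if i = n then 1 else 0)"

datatype edge = West | East | South | North

text \<open>\<open>transform\<close> maps the reference square to the block; \<open>num_cells B i\<close> is \<open>N\<^sub>i\<close>. Indices in the type \<open>2\<close> are
  coordinate directions, and the real argument of the last four fields is time.\<close>

record sbp_block =
  transform :: "real^2 \<Rightarrow> real^2"
  num_cells :: "2 \<Rightarrow> nat"
  norm_H :: "2 \<Rightarrow> real mat"
  stiff_Q :: "2 \<Rightarrow> real mat"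
  velocity :: "2 \<Rightarrow> real \<Rightarrow> real vec"
  pressure :: "real \<Rightarrow> real vec"
  pressure_star :: "edge \<Rightarrow> real \<Rightarrow> real vec"
  velocity_star :: "edge \<Rightarrow> real \<Rightarrow> real vec"

definition ref_square :: "(real^2) set" where
  "ref_square = {\<xi>. \<forall>i. vec_nth \<xi> i \<in> {-1..1}}"

definition jacobian_det :: "sbp_block \<Rightarrow> real^2 \<Rightarrow> real" where
  "jacobian_det B \<xi> =
     Determinants.det (matrix (frechet_derivative (transform B) (at \<xi> within ref_square)))"

text \<open>\<open>metric B i j \<xi>\<close> is \<open>\<partial>\<xi>\<^sub>i / \<partial>x\<^sub>j\<close> at the point \<open>x(\<xi>)\<close>.\<close>

definition metric :: "sbp_block \<Rightarrow> 2 \<Rightarrow> 2 \<Rightarrow> real^2 \<Rightarrow> real" where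
  "metric B i j \<xi> =
     vec_nth (vec_nth (matrix (frechet_derivative (inv_into ref_square (transform B))
       (at (transform B \<xi>) within transform B ` ref_square))) i) j"

definition num_points :: "sbp_block \<Rightarrow> nat" where
  "num_points B = (num_cells B 1 + 1) * (num_cells B 2 + 1)"

definition grid_point :: "sbp_block \<Rightarrow> nat \<Rightarrow> real^2" where
  "grid_point B r = (\<chi> i. -1 + 2 * real (if i = 1 then r div (num_cells B 2 + 1)
     else r mod (num_cells B 2 + 1)) / real (num_cells B i))"

definition mat_J :: "sbp_block \<Rightarrow> real mat" where
  "mat_J B = mat_diag (num_points B) (\<lambda>r. jacobian_det B (grid_point B r))"

definition mat_X :: "sbp_block \<Rightarrow> 2 \<Rightarrow> 2 \<Rightarrow> real mat" where
  "mat_X B i j = mat_diag (num_points B) (\<lambda>r. metric B i j (grid_point B r))"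

definition mat_H :: "sbp_block \<Rightarrow> real mat" where
  "mat_H B = kron (norm_H B 1) (norm_H B 2)"

definition mat_D :: "sbp_block \<Rightarrow> 2 \<Rightarrow> real mat" where
  "mat_D B a = (if a = 1
     then kron (diag_powr (norm_H B 1) (-1) * stiff_Q B 1) (1\<^sub>m (num_cells B 2 + 1))
     else kron (1\<^sub>m (num_cells B 1 + 1)) (diag_powr (norm_H B 2) (-1) * stiff_Q B 2))"


subsection \<open>Edges\<close>

text \<open>An edge is the subset \<open>\<xi>\<^sub>a = \<plusminus>1\<close> of the reference square.\<close>

fun edge_dir :: "edge \<Rightarrow> 2" where
  "edge_dir West = 1" | "edge_dir East = 1" | "edge_dir South = 2" | "edge_dir North = 2"

fun edge_sign :: "edge \<Rightarrow> real" where
  "edge_sign West = -1" | "edge_sign East = 1" | "edge_sign South = -1" | "edge_sign North = 1"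

fun edge_tangent :: "edge \<Rightarrow> 2" where
  "edge_tangent West = 2" | "edge_tangent East = 2" | "edge_tangent South = 1" | "edge_tangent North = 1"

definition edge_points :: "edge \<Rightarrow> (real^2) set" where
  "edge_points K = {\<xi> \<in> ref_square. vec_nth \<xi> (edge_dir K) = edge_sign K}"

definition edge_size :: "sbp_block \<Rightarrow> edge \<Rightarrow> nat" where
  "edge_size B K = num_cells B (edge_tangent K) + 1"

text \<open>Position in a grid vector of the \<open>j\<close>-th point of an edge; the \<open>\<xi>\<^sub>2\<close>-index runs fastest.\<close>

fun edge_index :: "sbp_block \<Rightarrow> edge \<Rightarrow> nat \<Rightarrow> nat" where
  "edge_index B West j = j"
| "edge_index B East j = num_cells B 1 * (num_cells B 2 + 1) + j"
| "edge_index B South j = j * (num_cells B 2 + 1)"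
| "edge_index B North j = j * (num_cells B 2 + 1) + num_cells B 2"

definition edge_restrict :: "sbp_block \<Rightarrow> edge \<Rightarrow> real vec \<Rightarrow> real vec" where
  "edge_restrict B K u = vec (edge_size B K) (\<lambda>j. u $ edge_index B K j)"

definition surface_jacobian :: "sbp_block \<Rightarrow> edge \<Rightarrow> real^2 \<Rightarrow> real" where
  "surface_jacobian B K \<xi> = jacobian_det B \<xi> *
     sqrt ((metric B (edge_dir K) 1 \<xi>)\<^sup>2 + (metric B (edge_dir K) 2 \<xi>)\<^sup>2)"

definition outward_normal :: "sbp_block \<Rightarrow> edge \<Rightarrow> 2 \<Rightarrow> real^2 \<Rightarrow> real" where
  "outward_normal B K i \<xi> =
     edge_sign K * (jacobian_det B \<xi> / surface_jacobian B K \<xi>) * metric B (edge_dir K) i \<xi>"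

definition edge_SJ :: "sbp_block \<Rightarrow> edge \<Rightarrow> real mat" where
  "edge_SJ B K = mat_diag (edge_size B K)
     (\<lambda>j. surface_jacobian B K (grid_point B (edge_index B K j)))"

definition edge_n :: "sbp_block \<Rightarrow> edge \<Rightarrow> 2 \<Rightarrow> real mat" where
  "edge_n B K i = mat_diag (edge_size B K)
     (\<lambda>j. outward_normal B K i (grid_point B (edge_index B K j)))"

definition edge_H :: "sbp_block \<Rightarrow> edge \<Rightarrow> real mat" where
  "edge_H B K = norm_H B (edge_tangent K)"

definition edge_p :: "sbp_block \<Rightarrow> edge \<Rightarrow> real \<Rightarrow> real vec" where
  "edge_p B K t = edge_restrict B K (pressure B t)"

definition edge_v :: "sbp_block \<Rightarrow> edge \<Rightarrow> real \<Rightarrow> real vec" where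
  "edge_v B K t = edge_n B K 1 *\<^sub>v edge_restrict B K (velocity B 1 t)
     + edge_n B K 2 *\<^sub>v edge_restrict B K (velocity B 2 t)"

definition sbp_block :: "sbp_block \<Rightarrow> bool" where
  "sbp_block B \<longleftrightarrow>
     inj_on (transform B) ref_square \<and>
     transform B differentiable_on ref_square \<and>
     inv_into ref_square (transform B) differentiable_on (transform B ` ref_square) \<and>
     (\<forall>\<xi>\<in>ref_square. 0 < jacobian_det B \<xi>) \<and>
     (\<forall>i. sbp_operator (num_cells B i) (norm_H B i) (stiff_Q B i)) \<and>
     (\<forall>i t. velocity B i t \<in> carrier_vec (num_points B)) \<and>
     (\<forall>t. pressure B t \<in> carrier_vec (num_points B)) \<and>
     (\<forall>K t. pressure_star B K t \<in> carrier_vec (edge_size B K)) \<and>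
     (\<forall>K t. velocity_star B K t \<in> carrier_vec (edge_size B K))"


subsection \<open>Semi-discretization and energy dissipation rate\<close>

definition assemble_edges :: "sbp_block \<Rightarrow> (edge \<Rightarrow> real vec) \<Rightarrow> real vec" where
  "assemble_edges B F =
     kron_vec (unit_vec (num_cells B 1 + 1) 0) (F West)
     + kron_vec (unit_vec (num_cells B 1 + 1) (num_cells B 1)) (F East)
     + kron_vec (F South) (unit_vec (num_cells B 2 + 1) 0)
     + kron_vec (F North) (unit_vec (num_cells B 2 + 1) (num_cells B 2))"

definition penalty_v :: "sbp_block \<Rightarrow> 2 \<Rightarrow> real \<Rightarrow> real vec" where
  "penalty_v B i t = assemble_edges B
     (\<lambda>K. edge_H B K *\<^sub>v (edge_SJ B K *\<^sub>v (edge_n B K i *\<^sub>v (pressure_star B K t - edge_p B K t))))"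

definition penalty_p :: "sbp_block \<Rightarrow> real \<Rightarrow> real vec" where
  "penalty_p B t = assemble_edges B
     (\<lambda>K. edge_H B K *\<^sub>v (edge_SJ B K *\<^sub>v (velocity_star B K t - edge_v B K t)))"

definition has_time_derivative ::
    "(real \<Rightarrow> real vec) \<Rightarrow> real vec \<Rightarrow> real \<Rightarrow> real set \<Rightarrow> bool" where
  "has_time_derivative u u' t T \<longleftrightarrow> dim_vec u' = dim_vec (u t) \<and>
     (\<forall>r<dim_vec (u t). ((\<lambda>s. u s $ r) has_real_derivative u' $ r) (at t within T))"

definition semi_discretization :: "real \<Rightarrow> real \<Rightarrow> real set \<Rightarrow> sbp_block \<Rightarrow> bool" where
  "semi_discretization \<rho> lam T B \<longleftrightarrow> (\<forall>t\<in>T.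
     (\<forall>i. \<exists>dv. has_time_derivative (velocity B i) dv t T \<and>
        \<rho> \<cdot>\<^sub>v (mat_J B *\<^sub>v dv)
        + mat_D B 1 *\<^sub>v (mat_J B *\<^sub>v (mat_X B 1 i *\<^sub>v pressure B t))
        + mat_D B 2 *\<^sub>v (mat_J B *\<^sub>v (mat_X B 2 i *\<^sub>v pressure B t))
        = - (diag_powr (mat_H B) (-1) *\<^sub>v penalty_v B i t)) \<and>
     (\<exists>dp. has_time_derivative (pressure B) dp t T \<and>
        mat_J B *\<^sub>v dp
        + lam \<cdot>\<^sub>v (mat_J B *\<^sub>v (mat_X B 1 1 *\<^sub>v (mat_D B 1 *\<^sub>v velocity B 1 t))
            + mat_J B *\<^sub>v (mat_X B 1 2 *\<^sub>v (mat_D B 1 *\<^sub>v velocity B 2 t))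
            + mat_J B *\<^sub>v (mat_X B 2 1 *\<^sub>v (mat_D B 2 *\<^sub>v velocity B 1 t))
            + mat_J B *\<^sub>v (mat_X B 2 2 *\<^sub>v (mat_D B 2 *\<^sub>v velocity B 2 t)))
        = - (lam \<cdot>\<^sub>v (diag_powr (mat_H B) (-1) *\<^sub>v penalty_p B t))))"

definition edge_dissipation :: "sbp_block \<Rightarrow> edge \<Rightarrow> real \<Rightarrow> real" where
  "edge_dissipation B K t =
     - (edge_v B K t \<bullet> (edge_H B K *\<^sub>v (edge_SJ B K *\<^sub>v pressure_star B K t)))
     + edge_v B K t \<bullet> (edge_H B K *\<^sub>v (edge_SJ B K *\<^sub>v edge_p B K t))
     - velocity_star B K t \<bullet> (edge_H B K *\<^sub>v (edge_SJ B K *\<^sub>v edge_p B K t))"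


section \<open>Glue grid\<close>

text \<open>\<open>glue_nodes\<close> are the interval boundaries and \<open>glue_basis\<close> is the basis \<open>\<psi>\<close>.\<close>

record glue_grid =
  glue_nodes :: "real list"
  glue_basis :: "(real \<Rightarrow> real) list"

text \<open>The basis functions are square integrable, so that the mass matrix exists. Linear independence
  is understood modulo null sets, as for elements of \<open>L\<^sup>2\<close>; this is what makes the mass matrix positive
  definite. The basis is listed interval by interval (\<open>c\<close> gives the interval of a basis function), so
  that the coefficients belonging to a block are contiguous.\<close>

definition glue_grid :: "glue_grid \<Rightarrow> bool" where
  "glue_grid G \<longleftrightarrow>
     2 \<le> length (glue_nodes G) \<and> sorted_wrt (<) (glue_nodes G) \<and>
     hd (glue_nodes G) = -1 \<and> last (glue_nodes G) = 1 \<and>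
     (\<forall>\<psi>\<in>set (glue_basis G). set_borel_measurable lborel {-1..1} \<psi> \<and>
        set_integrable lborel {-1..1} (\<lambda>\<eta>. (\<psi> \<eta>)\<^sup>2)) \<and>
     (\<exists>c. (\<forall>j<length (glue_basis G). c j + 1 < length (glue_nodes G) \<and>
             (\<forall>\<eta>. (glue_basis G ! j) \<eta> \<noteq> 0 \<longrightarrow>
                \<eta> \<in> {glue_nodes G ! c j..glue_nodes G ! (c j + 1)})) \<and>
          (\<forall>i j. i \<le> j \<and> j < length (glue_basis G) \<longrightarrow> c i \<le> (c j :: nat))) \<and>
     (\<forall>a :: nat \<Rightarrow> real.
        (AE \<eta> in lborel. \<eta> \<in> {-1..1} \<longrightarrow>
           (\<Sum>j<length (glue_basis G). a j * (glue_basis G ! j) \<eta>) = 0) \<longrightarrow>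
        (\<forall>j<length (glue_basis G). a j = 0))"

definition mass_matrix :: "(real \<Rightarrow> real) list \<Rightarrow> real \<Rightarrow> real \<Rightarrow> real mat" where
  "mass_matrix \<psi>s a b = mat (length \<psi>s) (length \<psi>s)
     (\<lambda>(i, j). LINT \<eta>:{a..b}|lborel. (\<psi>s ! i) \<eta> * (\<psi>s ! j) \<eta>)"

definition glue_mass :: "glue_grid \<Rightarrow> real mat" where
  "glue_mass G = mass_matrix (glue_basis G) (-1) 1"

definition glue_portion :: "glue_grid \<Rightarrow> real \<Rightarrow> real \<Rightarrow> (real \<Rightarrow> real) list" where
  "glue_portion G a b = filter (\<lambda>\<psi>. \<forall>\<eta>. \<psi> \<eta> \<noteq> 0 \<longrightarrow> \<eta> \<in> {a..b}) (glue_basis G)"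


section \<open>Interfaces\<close>

datatype side = Minus | Plus

fun opposite :: "side \<Rightarrow> side" where
  "opposite Minus = Plus" | "opposite Plus = Minus"

text \<open>The blocks on side \<open>s\<close> are numbered \<open>1, \<dots>, num_blocks I s\<close>; \<open>block_edge I s k\<close> is the edge of block
  \<open>k\<close> that lies on the interface.\<close>

record interface =
  curve :: "real \<Rightarrow> real^2"
  glue :: "glue_grid"
  num_blocks :: "side \<Rightarrow> nat"
  end_point :: "side \<Rightarrow> nat \<Rightarrow> real"
  block :: "side \<Rightarrow> nat \<Rightarrow> sbp_block"
  block_edge :: "side \<Rightarrow> nat \<Rightarrow> edge"
  P_f2g :: "side \<Rightarrow> nat \<Rightarrow> real mat"
  P_g2f :: "side \<Rightarrow> nat \<Rightarrow> real mat"

definition half_width :: "interface \<Rightarrow> side \<Rightarrow> nat \<Rightarrow> real" where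
  "half_width I s k = (end_point I s k - end_point I s (k - 1)) / 2"

definition if_p :: "interface \<Rightarrow> side \<Rightarrow> nat \<Rightarrow> real \<Rightarrow> real vec" where
  "if_p I s k t = edge_p (block I s k) (block_edge I s k) t"

definition if_v :: "interface \<Rightarrow> side \<Rightarrow> nat \<Rightarrow> real \<Rightarrow> real vec" where
  "if_v I s k t = edge_v (block I s k) (block_edge I s k) t"

definition if_pstar :: "interface \<Rightarrow> side \<Rightarrow> nat \<Rightarrow> real \<Rightarrow> real vec" where
  "if_pstar I s k t = pressure_star (block I s k) (block_edge I s k) t"

definition if_vstar :: "interface \<Rightarrow> side \<Rightarrow> nat \<Rightarrow> real \<Rightarrow> real vec" where
  "if_vstar I s k t = velocity_star (block I s k) (block_edge I s k) t"

definition if_H :: "interface \<Rightarrow> side \<Rightarrow> nat \<Rightarrow> real mat" where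
  "if_H I s k = edge_H (block I s k) (block_edge I s k)"

definition if_size :: "interface \<Rightarrow> side \<Rightarrow> nat \<Rightarrow> nat" where
  "if_size I s k = edge_size (block I s k) (block_edge I s k)"

definition if_scale :: "interface \<Rightarrow> side \<Rightarrow> nat \<Rightarrow> real \<Rightarrow> real mat" where
  "if_scale I s k r =
     diag_powr ((1 / half_width I s k) \<cdot>\<^sub>m edge_SJ (block I s k) (block_edge I s k)) r"

definition block_portion :: "interface \<Rightarrow> side \<Rightarrow> nat \<Rightarrow> (real \<Rightarrow> real) list" where
  "block_portion I s k = glue_portion (glue I) (end_point I s (k - 1)) (end_point I s k)"

text \<open>For a valid interface, these are the diagonal blocks of \<^term>\<open>glue_mass (glue I)\<close>, for either side:
  products of basis functions of different blocks vanish almost everywhere.\<close>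

definition block_mass :: "interface \<Rightarrow> side \<Rightarrow> nat \<Rightarrow> real mat" where
  "block_mass I s k =
     mass_matrix (block_portion I s k) (end_point I s (k - 1)) (end_point I s k)"

text \<open>The entries of a glue coefficient vector that belong to block \<open>k\<close> of side \<open>s\<close>.\<close>

definition portion :: "interface \<Rightarrow> side \<Rightarrow> nat \<Rightarrow> real vec \<Rightarrow> real vec" where
  "portion I s k w = vec (length (block_portion I s k))
     (\<lambda>i. w $ ((\<Sum>l = 1..<k. length (block_portion I s l)) + i))"

definition block_pbar :: "interface \<Rightarrow> side \<Rightarrow> nat \<Rightarrow> real \<Rightarrow> real vec" where
  "block_pbar I s k t = P_f2g I s k *\<^sub>v (if_scale I s k (1/2) *\<^sub>v if_p I s k t)"

definition block_vbar :: "interface \<Rightarrow> side \<Rightarrow> nat \<Rightarrow> real \<Rightarrow> real vec" where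
  "block_vbar I s k t = P_f2g I s k *\<^sub>v (if_scale I s k (1/2) *\<^sub>v if_v I s k t)"

definition pbar :: "interface \<Rightarrow> side \<Rightarrow> real \<Rightarrow> real vec" where
  "pbar I s t = stack (map (\<lambda>k. block_pbar I s k t) [1..<num_blocks I s + 1])"

definition vbar :: "interface \<Rightarrow> side \<Rightarrow> real \<Rightarrow> real vec" where
  "vbar I s t = stack (map (\<lambda>k. block_vbar I s k t) [1..<num_blocks I s + 1])"

text \<open>The values on the glue grid prescribed to side \<open>s\<close>.\<close>

definition pbar_star :: "real \<Rightarrow> real \<Rightarrow> interface \<Rightarrow> side \<Rightarrow> real \<Rightarrow> real vec" where
  "pbar_star \<alpha> Z I s t = pbar I s t
     + ((1/2) \<cdot>\<^sub>v (pbar I (opposite s) t - pbar I s t)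
        + (\<alpha> * (Z / 2)) \<cdot>\<^sub>v (vbar I (opposite s) t + vbar I s t))"

definition vbar_star :: "real \<Rightarrow> real \<Rightarrow> interface \<Rightarrow> side \<Rightarrow> real \<Rightarrow> real vec" where
  "vbar_star \<alpha> Z I s t = vbar I s t
     + (- ((1/2) \<cdot>\<^sub>v (vbar I (opposite s) t + vbar I s t))
        - (\<alpha> * (1 / (2 * Z))) \<cdot>\<^sub>v (pbar I (opposite s) t - pbar I s t))"

definition interface :: "interface \<Rightarrow> bool" where
  "interface I \<longleftrightarrow>
     continuous_on {-1..1} (curve I) \<and> inj_on (curve I) {-1<..<1} \<and>
     glue_grid (glue I) \<and>
     (\<forall>s. end_point I s 0 = -1 \<and> end_point I s (num_blocks I s) = 1 \<and>
        (\<forall>k<num_blocks I s. end_point I s k < end_point I s (k + 1)) \<and>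
        (\<forall>k\<le>num_blocks I s. end_point I s k \<in> set (glue_nodes (glue I))) \<and>
        (\<forall>k\<in>{1..num_blocks I s}.
           sbp_block (block I s k) \<and>
           transform (block I s k) ` edge_points (block_edge I s k)
             = curve I ` {end_point I s (k - 1)..end_point I s k} \<and>
           P_f2g I s k \<in> carrier_mat (length (block_portion I s k)) (if_size I s k) \<and>
           P_g2f I s k \<in> carrier_mat (if_size I s k) (length (block_portion I s k)) \<and>
           half_width I s k \<cdot>\<^sub>m (transpose_mat (P_g2f I s k) * if_H I s k)
             = block_mass I s k * P_f2g I s k))"

definition dissipation :: "interface \<Rightarrow> side \<Rightarrow> real \<Rightarrow> real" where
  "dissipation I s t =
     (\<Sum>k = 1..num_blocks I s. edge_dissipation (block I s k) (block_edge I s k) t)"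

end

theory Submission
  imports Defs
begin

text \<open>The compatibility condition on the projections turns every pairing of an edge vector with
  interpolated glue data, weighted by \<open>H S\<^sub>J\<close>, into an \<open>M\<close>-pairing of glue vectors. The half-weighted correction
  terms cancel the edge pairing of \<open>v\<close> with \<open>p\<close>, so each block contributes
  \<open>- v\<^sup>T M (p\<^sup>* - p) - p\<^sup>T M (v\<^sup>* - v) - v\<^sup>T M p\<close> in barred quantities. Since a basis function cannot be
  supported at a single point, it belongs to exactly one block of each side; hence \<open>M\<close> is
  block diagonal for both sides and the contributions of a side add up to the same expression in the
  stacked vectors. Inserting the prescribed glue values, the cross terms of the two sides cancel and the
  upwind terms complete to squares in the positive semidefinite form of \<open>M\<close>.\<close>

section \<open>Offsets into concatenated lists and stacked vectors\<close>

lemma offset_add_less: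
  fixes len :: "nat \<Rightarrow> nat"
  assumes "k \<in> {1..n}" and "i < len k"
  shows "(\<Sum>l = 1..<k. len l) + i < (\<Sum>l = 1..<Suc n. len l)"
proof -
  have "(\<Sum>l = 1..<k. len l) + i < (\<Sum>l = 1..<Suc k. len l)"
    using assms by simp
  also have "\<dots> \<le> (\<Sum>l = 1..<Suc n. len l)"
    using assms(1) by (intro sum_mono2) auto
  finally show ?thesis .
qed

lemma length_concat_upt:
  "length (concat (map L [1..<Suc n])) = (\<Sum>l = 1..<Suc n. length (L l))"
  by (induction n) auto

lemma concat_upt_nth:
  assumes "k \<in> {1..n}" and "i < length (L k)"
  shows "concat (map L [1..<Suc n]) ! ((\<Sum>l = 1..<k. length (L l)) + i) = L k ! i"
  using assms
proof (induction n)
  case (Suc n)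
  have split: "concat (map L [1..<Suc (Suc n)]) = concat (map L [1..<Suc n]) @ L (Suc n)"
    by simp
  show ?case
  proof (cases "k = Suc n")
    case True
    show ?thesis
      unfolding split True length_concat_upt[symmetric] by (simp only: nth_append_length_plus)
  next
    case False
    with Suc.prems have k: "k \<in> {1..n}" by auto
    have "(\<Sum>l = 1..<k. length (L l)) + i < length (concat (map L [1..<Suc n]))"
      unfolding length_concat_upt using k Suc.prems(2) by (rule offset_add_less)
    then show ?thesis
      unfolding split using Suc.IH[OF k Suc.prems(2)] by (simp only: nth_append if_True)
  qed
qed simp

lemma sum_lessThan_add:
  "sum f {..<a + b} = sum f {..<a} + (\<Sum>i<b. f (a + i))" for f :: "nat \<Rightarrow> 'a::comm_monoid_add"
  by (induction b) (auto simp: add.assoc)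

text \<open>Serves to reindex a sum over all glue coefficients by block and by position within the
  block.\<close>

lemma sum_offsets:
  fixes f :: "nat \<Rightarrow> 'a::comm_monoid_add" and len :: "nat \<Rightarrow> nat"
  shows "(\<Sum>j<(\<Sum>l = 1..<Suc n. len l). f j) =
    (\<Sum>k = 1..n. \<Sum>i<len k. f ((\<Sum>l = 1..<k. len l) + i))"
  by (induction n) (auto simp: sum_lessThan_add)

text \<open>Once a key exceeds \<open>n\<close>, sortedness forces all later keys to exceed it, so
  the two filters are a prefix and a suffix.\<close>

lemma sorted_partition:
  fixes \<kappa> :: "'a \<Rightarrow> nat"
  assumes "sorted (map \<kappa> xs)"
  shows "xs = filter (\<lambda>x. \<kappa> x \<le> n) xs @ filter (\<lambda>x. n < \<kappa> x) xs"
  using assms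
proof (induction xs)
  case (Cons x xs)
  show ?case
  proof (cases "\<kappa> x \<le> n")
    case True
    then show ?thesis using Cons by auto
  next
    case False
    then have "\<forall>y\<in>set xs. n < \<kappa> y" using Cons.prems by auto
    then have "filter (\<lambda>x. \<kappa> x \<le> n) xs = []" "filter (\<lambda>x. n < \<kappa> x) xs = xs"
      by (auto simp: filter_empty_conv filter_id_conv not_le)
    then show ?thesis using False by simp
  qed
qed simp

text \<open>The induction splits off the elements with the largest key by
  \<open>sorted_partition\<close>. With the block number of a basis function as key, this shows that
  the coefficients of each block are contiguous and that the blocks come in order.\<close>

lemma sorted_concat_filter:
  fixes \<kappa> :: "'a \<Rightarrow> nat"
  assumes "sorted (map \<kappa> xs)" and "\<forall>x\<in>set xs. \<kappa> x \<in> {1..n}"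
  shows "concat (map (\<lambda>k. filter (\<lambda>x. \<kappa> x = k) xs) [1..<Suc n]) = xs"
  using assms
proof (induction n arbitrary: xs)
  case 0
  then show ?case by (cases xs) auto
next
  case (Suc n)
  let ?ys = "filter (\<lambda>x. \<kappa> x \<le> n) xs"
  have "concat (map (\<lambda>k. filter (\<lambda>x. \<kappa> x = k) ?ys) [1..<Suc n]) = ?ys"
    using Suc.prems by (intro Suc.IH) (auto simp: sorted_filter)
  moreover have "map (\<lambda>k. filter (\<lambda>x. \<kappa> x = k) ?ys) [1..<Suc n] =
      map (\<lambda>k. filter (\<lambda>x. \<kappa> x = k) xs) [1..<Suc n]"
    by (intro map_cong refl) (auto intro!: filter_cong)
  moreover have "filter (\<lambda>x. \<kappa> x = Suc n) xs = filter (\<lambda>x. n < \<kappa> x) xs"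
    using Suc.prems by (intro filter_cong) auto
  ultimately show ?case
    using sorted_partition[OF Suc.prems(1), of n, symmetric]
    by (simp add: upt_Suc_append del: upt_Suc map_eq_conv)
qed

text \<open>Transfers stacking to lists, where the offset lemmas about \<open>concat\<close>
  apply.\<close>

lemma list_of_vec_stack: "list_of_vec (stack us) = concat (map list_of_vec us)"
  by (induction us) (auto simp: stack_def)

lemma stack_upt_nth:
  assumes "k \<in> {1..n}" and "i < dim_vec (u k)"
  shows "stack (map u [1..<Suc n]) $ ((\<Sum>l = 1..<k. dim_vec (u l)) + i) = u k $ i"
proof -
  let ?o = "(\<Sum>l = 1..<k. dim_vec (u l)) + i"
  have "list_of_vec (stack (map u [1..<Suc n])) ! ?o = list_of_vec (u k) ! i"
    using concat_upt_nth[of k n i "\<lambda>l. list_of_vec (u l)"] assms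
    by (simp only: list_of_vec_stack map_map comp_def length_list_of_vec)
  then show ?thesis by (simp only: list_of_vec_index)
qed

lemma dim_stack_upt: "dim_vec (stack (map u [1..<Suc n])) = (\<Sum>l = 1..<Suc n. dim_vec (u l))"
proof -
  have "length (list_of_vec (stack (map u [1..<Suc n]))) = (\<Sum>l = 1..<Suc n. dim_vec (u l))"
    using length_concat_upt[of "\<lambda>l. list_of_vec (u l)" n]
    by (simp only: list_of_vec_stack map_map comp_def length_list_of_vec)
  then show ?thesis by (simp only: length_list_of_vec)
qed

section \<open>Pairings weighted by diagonal matrices and their transfer to the glue grid\<close>

lemma scalar_prod_mat_eq_sum:
  assumes "A \<in> carrier_mat n m" and "x \<in> carrier_vec n" and "y \<in> carrier_vec m"
  shows "x \<bullet> (A *\<^sub>v y) = (\<Sum>i<n. \<Sum>j<m. x $ i * A $$ (i, j) * y $ j)"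
  using assms by (auto simp: scalar_prod_def lessThan_atLeast0 sum_distrib_left mult.assoc)

lemma diag_mult_vec_nth:
  assumes "A \<in> carrier_mat n n" and "diagonal_mat A" and "x \<in> carrier_vec n" and "i < n"
  shows "(A *\<^sub>v x) $ i = A $$ (i, i) * x $ i"
proof -
  have "(A *\<^sub>v x) $ i = (\<Sum>j<n. A $$ (i, j) * x $ j)"
    using assms by (auto simp: scalar_prod_def lessThan_atLeast0)
  also have "\<dots> = (\<Sum>j<n. if j = i then A $$ (i, i) * x $ i else 0)"
    using assms by (intro sum.cong refl) (auto simp: diagonal_mat_def)
  also have "\<dots> = A $$ (i, i) * x $ i"
    using assms(4) by simp
  finally show ?thesis .
qed

lemma mat_diag_mult_vec_nth:
  fixes x :: "real vec"
  assumes "x \<in> carrier_vec n" and "i < n"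
  shows "(mat_diag n f *\<^sub>v x) $ i = f i * x $ i"
  using diag_mult_vec_nth[of "mat_diag n f" n x i] assms
  by (simp add: diagonal_mat_def mat_diag_def)

lemma diag_scale_eq:
  "diag_powr (c \<cdot>\<^sub>m mat_diag n \<sigma>) r = mat_diag n (\<lambda>i. (c * \<sigma> i) powr r)"
  by (rule eq_matI) (auto simp: diag_powr_def mat_diag_def)

text \<open>At \<open>x = 0\<close> both sides are 0 by the convention \<open>0 powr r = 0\<close>,
  so the identity is available for every nonnegative surface Jacobian entry.\<close>

lemma mult_powr_neg_half:
  fixes x :: real
  assumes "0 \<le> x"
  shows "x * x powr (-1/2) = x powr (1/2)"
proof (cases "x = 0")
  case False
  then have "x * x powr (-1/2) = x powr 1 * x powr (-1/2)" using assms by simp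
  also have "\<dots> = x powr (1 + -1/2)" by (rule powr_add[symmetric])
  finally show ?thesis by simp
qed simp

lemma smult_mat_mult_vec:
  fixes A :: "real mat"
  assumes "A \<in> carrier_mat n m" and "x \<in> carrier_vec m"
  shows "(c \<cdot>\<^sub>m A) *\<^sub>v x = c \<cdot>\<^sub>v (A *\<^sub>v x)"
  using assms by (intro eq_vecI) (auto simp: scalar_prod_def sum_distrib_left mult.assoc)

text \<open>Write S for the diagonal matrix \<open>\<sigma> / d\<close>. Then
  \<open>\<sigma> S^(-1/2) = d S^(1/2)\<close>, diagonal matrices commute, and the transposed
  compatibility condition replaces \<open>d H Pg\<close> by \<open>Pf^T M\<close>.\<close>

lemma edge_to_glue:
  fixes \<sigma> :: "nat \<Rightarrow> real"
  assumes H: "H \<in> carrier_mat n n" "diagonal_mat H"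
    and \<sigma>: "\<And>i. i < n \<Longrightarrow> 0 \<le> \<sigma> i" and d: "0 < d"
    and Pf: "Pf \<in> carrier_mat m n" and Pg: "Pg \<in> carrier_mat n m"
    and M: "M \<in> carrier_mat m m" "transpose_mat M = M"
    and compat: "d \<cdot>\<^sub>m (transpose_mat Pg * H) = M * Pf"
    and v: "v \<in> carrier_vec n" and a: "a \<in> carrier_vec m"
  shows "v \<bullet> (H *\<^sub>v (mat_diag n \<sigma> *\<^sub>v
      (diag_powr ((1 / d) \<cdot>\<^sub>m mat_diag n \<sigma>) (-1/2) *\<^sub>v (Pg *\<^sub>v a)))) =
    (Pf *\<^sub>v (diag_powr ((1 / d) \<cdot>\<^sub>m mat_diag n \<sigma>) (1/2) *\<^sub>v v)) \<bullet> (M *\<^sub>v a)"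
proof -
  define w where "w = Pg *\<^sub>v a"
  have w: "w \<in> carrier_vec n" unfolding w_def using Pg a by simp
  define s where "s = mat_diag n (\<lambda>i. ((1 / d) * \<sigma> i) powr (1/2)) *\<^sub>v v"
  have s: "s \<in> carrier_vec n" unfolding s_def using v mat_diag_dim by (rule_tac mult_mat_vec_carrier)
  define r where "r = mat_diag n (\<lambda>i. ((1 / d) * \<sigma> i) powr (-1/2)) *\<^sub>v w"
  have r: "r \<in> carrier_vec n" unfolding r_def using w mat_diag_dim by (rule_tac mult_mat_vec_carrier)
  have Hd: "transpose_mat H = H"
  proof (rule eq_matI)
    fix i j assume "i < dim_row H" "j < dim_col H"
    then show "transpose_mat H $$ (i, j) = H $$ (i, j)"
      using H by (cases "i = j") (auto simp: diagonal_mat_def)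
  qed (use H in auto)
  \<comment> \<open>The compatibility condition is transposed, using that \<open>H\<close> and
    \<open>M\<close> are symmetric; in this form \<open>Pf\<close> can be moved to the other side of
    the pairing.\<close>
  have PfM: "transpose_mat Pf * M = d \<cdot>\<^sub>m (H * Pg)"
  proof -
    have "transpose_mat Pf * M = transpose_mat (M * Pf)"
      using M Pf by (simp add: transpose_mult)
    also have "\<dots> = transpose_mat (d \<cdot>\<^sub>m (transpose_mat Pg * H))" by (simp add: compat)
    also have "\<dots> = d \<cdot>\<^sub>m transpose_mat (transpose_mat Pg * H)" by (intro eq_matI) auto
    also have "transpose_mat (transpose_mat Pg * H) = H * Pg"
      using Pg H Hd by (simp add: transpose_mult[of _ m n _ n])
    finally show ?thesis .
  qed
  have "(Pf *\<^sub>v s) \<bullet> (M *\<^sub>v a) = s \<bullet> (transpose_mat Pf *\<^sub>v (M *\<^sub>v a))"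
    using transpose_vec_mult_scalar[of "transpose_mat Pf" n m "M *\<^sub>v a" s] Pf M a s by simp
  also have "transpose_mat Pf *\<^sub>v (M *\<^sub>v a) = (d \<cdot>\<^sub>m (H * Pg)) *\<^sub>v a"
    using Pf M a PfM by (simp add: assoc_mult_mat_vec[of _ n m _ m, symmetric])
  also have "\<dots> = d \<cdot>\<^sub>v (H *\<^sub>v w)"
    unfolding w_def using H Pg a
    by (simp add: smult_mat_mult_vec[of _ n m])
  also have "s \<bullet> (d \<cdot>\<^sub>v (H *\<^sub>v w)) = (\<Sum>i<n. s $ i * (d * (H $$ (i, i) * w $ i)))"
    using H w s by (simp add: scalar_prod_def lessThan_atLeast0 diag_mult_vec_nth del: index_mult_mat_vec)
  also have "\<dots> = (\<Sum>i<n. v $ i * (H $$ (i, i) * (\<sigma> i * r $ i)))"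
  proof (intro sum.cong refl)
    fix i assume "i \<in> {..<n}"
    then have i: "i < n" by simp
    \<comment> \<open>The factor \<open>d\<close> supplied by the compatibility condition absorbs
      the \<open>1 / d\<close> in the scaling, which leaves \<sigma> times the power -1/2.\<close>
    have "d * s $ i = d * (((1 / d) * \<sigma> i) powr (1/2) * v $ i)"
      unfolding s_def using v i by (simp add: mat_diag_mult_vec_nth del: index_mult_mat_vec)
    also have "((1 / d) * \<sigma> i) powr (1/2) = (1 / d) * \<sigma> i * ((1 / d) * \<sigma> i) powr (-1/2)"
      using \<sigma>[OF i] d by (intro mult_powr_neg_half[symmetric]) simp
    finally have "d * s $ i * w $ i = v $ i * \<sigma> i * (((1 / d) * \<sigma> i) powr (-1/2) * w $ i)"
      using d by simp
    also have "\<dots> = v $ i * \<sigma> i * r $ i"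
      unfolding r_def using w i by (simp add: mat_diag_mult_vec_nth del: index_mult_mat_vec)
    finally have "H $$ (i, i) * (d * s $ i * w $ i) = H $$ (i, i) * (v $ i * \<sigma> i * r $ i)" by simp
    then show "s $ i * (d * (H $$ (i, i) * w $ i)) = v $ i * (H $$ (i, i) * (\<sigma> i * r $ i))"
      by (simp add: algebra_simps)
  qed
  also have "\<dots> = v \<bullet> (H *\<^sub>v (mat_diag n \<sigma> *\<^sub>v r))"
  proof -
    have "mat_diag n \<sigma> *\<^sub>v r \<in> carrier_vec n" using r mat_diag_dim by (rule_tac mult_mat_vec_carrier)
    then show ?thesis
      using H r v
      by (simp add: scalar_prod_def lessThan_atLeast0 diag_mult_vec_nth mat_diag_mult_vec_nth
          del: index_mult_mat_vec)
  qed
  finally show ?thesis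
    unfolding diag_scale_eq s_def r_def w_def by simp
qed

lemma diag_pair_sym:
  fixes x y :: "real vec"
  assumes "H \<in> carrier_mat n n" "diagonal_mat H" and "x \<in> carrier_vec n" "y \<in> carrier_vec n"
  shows "x \<bullet> (H *\<^sub>v (mat_diag n \<sigma> *\<^sub>v y)) = y \<bullet> (H *\<^sub>v (mat_diag n \<sigma> *\<^sub>v x))"
proof -
  have "mat_diag n \<sigma> *\<^sub>v x \<in> carrier_vec n" "mat_diag n \<sigma> *\<^sub>v y \<in> carrier_vec n"
    using assms(3,4) mat_diag_dim by (rule_tac mult_mat_vec_carrier, auto)+
  then show ?thesis
    using assms
    by (simp add: scalar_prod_def diag_mult_vec_nth mat_diag_mult_vec_nth
        mult.commute mult.left_commute del: index_mult_mat_vec)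
qed

lemma diag_pair_sum:
  fixes x y :: "real vec"
  assumes "H \<in> carrier_mat n n" "diagonal_mat H" and "x \<in> carrier_vec n" "y \<in> carrier_vec n"
  shows "x \<bullet> (H *\<^sub>v (mat_diag n \<sigma> *\<^sub>v y)) = (\<Sum>i<n. x $ i * H $$ (i, i) * \<sigma> i * y $ i)"
proof -
  have "mat_diag n \<sigma> *\<^sub>v y \<in> carrier_vec n"
    by (rule mult_mat_vec_carrier[OF mat_diag_dim assms(4)])
  then show ?thesis
    using assms
    by (simp add: scalar_prod_def lessThan_atLeast0 diag_mult_vec_nth mat_diag_mult_vec_nth
        mult.assoc del: index_mult_mat_vec)
qed

text \<open>Solving the prescribed relation for \<open>q\<close> gives
  \<open>q = p/2 + a + b/2\<close>. The pairing with \<open>p\<close> thus enters with weight one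
  half, the weight on which the cancellation in \<open>block_dissipation\<close> rests.\<close>

lemma diag_pair_blend:
  fixes u p a b :: "real vec"
  assumes "H \<in> carrier_mat n n" "diagonal_mat H"
    and "u \<in> carrier_vec n" "p \<in> carrier_vec n" "a \<in> carrier_vec n" "b \<in> carrier_vec n"
    and "q - p = a + (1/2) \<cdot>\<^sub>v (b - p)" and "q \<in> carrier_vec n"
  shows "u \<bullet> (H *\<^sub>v (mat_diag n \<sigma> *\<^sub>v q)) = u \<bullet> (H *\<^sub>v (mat_diag n \<sigma> *\<^sub>v p)) / 2
    + u \<bullet> (H *\<^sub>v (mat_diag n \<sigma> *\<^sub>v a)) + u \<bullet> (H *\<^sub>v (mat_diag n \<sigma> *\<^sub>v b)) / 2"
proof -
  have q: "q $ i = p $ i / 2 + a $ i + b $ i / 2" if "i < n" for i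
  proof -
    have "(q - p) $ i = (a + (1/2) \<cdot>\<^sub>v (b - p)) $ i" using assms(7) by simp
    then show ?thesis using that assms(4-6,8) by (simp add: field_simps)
  qed
  have "(\<Sum>i<n. u $ i * H $$ (i, i) * \<sigma> i * q $ i) =
      (\<Sum>i<n. u $ i * H $$ (i, i) * \<sigma> i * p $ i / 2 + u $ i * H $$ (i, i) * \<sigma> i * a $ i
        + u $ i * H $$ (i, i) * \<sigma> i * b $ i / 2)"
    by (intro sum.cong refl) (simp add: q algebra_simps)
  then show ?thesis
    using assms by (simp add: diag_pair_sum sum.distrib sum_divide_distrib del: index_mult_mat_vec)
qed

lemma pair_add:
  fixes x u w :: "real vec"
  assumes "A \<in> carrier_mat n m" "x \<in> carrier_vec n" "u \<in> carrier_vec m" "w \<in> carrier_vec m"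
  shows "x \<bullet> (A *\<^sub>v (u + w)) = x \<bullet> (A *\<^sub>v u) + x \<bullet> (A *\<^sub>v w)"
  using assms
  by (subst mult_add_distrib_mat_vec[OF assms(1,3,4)], subst scalar_prod_add_distrib) auto

lemma pair_minus:
  fixes x u w :: "real vec"
  assumes "A \<in> carrier_mat n m" "x \<in> carrier_vec n" "u \<in> carrier_vec m" "w \<in> carrier_vec m"
  shows "x \<bullet> (A *\<^sub>v (u - w)) = x \<bullet> (A *\<^sub>v u) - x \<bullet> (A *\<^sub>v w)"
  using assms
  by (subst mult_minus_distrib_mat_vec[OF assms(1,3,4)], subst scalar_prod_minus_distrib) auto

lemma pair_smult:
  fixes x u :: "real vec"
  assumes "A \<in> carrier_mat n m" "x \<in> carrier_vec n" "u \<in> carrier_vec m"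
  shows "x \<bullet> (A *\<^sub>v (c \<cdot>\<^sub>v u)) = c * (x \<bullet> (A *\<^sub>v u))"
  using assms by (simp add: mult_mat_vec)

lemma pair_sym:
  fixes x y :: "real vec"
  assumes "A \<in> carrier_mat n n" "transpose_mat A = A" "x \<in> carrier_vec n" "y \<in> carrier_vec n"
  shows "x \<bullet> (A *\<^sub>v y) = y \<bullet> (A *\<^sub>v x)"
  using transpose_vec_mult_scalar[OF assms(1,4,3)] comm_scalar_prod[of "A *\<^sub>v x" n y] assms
  by simp

section \<open>Grid points, edges and the dissipation of a single block\<close>

lemma grid_point_in_ref_square:
  assumes "sbp_block B" and "r < num_points B"
  shows "grid_point B r \<in> ref_square"
proof -
  have N: "1 \<le> num_cells B i" for i
    using assms(1) by (auto simp: sbp_block_def sbp_operator_def)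
  have "vec_nth (grid_point B r) i \<in> {-1..1}" for i
  proof -
    define q where "q = (if i = 1 then r div (num_cells B 2 + 1) else r mod (num_cells B 2 + 1))"
    have "i = 1 \<or> i = 2" by (rule exhaust_2)
    then have "q \<le> num_cells B i"
    proof
      assume "i = 1"
      moreover have "r div (num_cells B 2 + 1) < num_cells B 1 + 1"
        using assms(2) by (simp add: num_points_def less_mult_imp_div_less)
      ultimately show ?thesis by (simp add: q_def)
    next
      assume "i = 2"
      \<comment> \<open>In the two-element type \<open>2\<close> the numeral 2 denotes 0, which
        makes the \<open>else\<close> branch of \<open>q\<close> the relevant one.\<close>
      moreover have "(2::2) \<noteq> 1" by simp
      ultimately have "q = r mod (num_cells B i + 1)" by (simp only: q_def if_False)
      then show ?thesis using mod_less_divisor[of "num_cells B i + 1" r] by linarith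
    qed
    then have "0 \<le> real q / real (num_cells B i)" "real q / real (num_cells B i) \<le> 1"
      using N[of i] by (auto simp: divide_simps)
    then show ?thesis by (simp add: grid_point_def q_def[symmetric])
  qed
  then show ?thesis by (simp add: ref_square_def)
qed

lemma edge_index_less:
  assumes "j < edge_size B K"
  shows "edge_index B K j < num_points B"
proof -
  \<comment> \<open>Row-major bound for row \<open>a\<close> and column \<open>b\<close>; its four
    instances below treat the west, east, south and north edge in this order.\<close>
  have split: "a * (m + 1) + b < (n + 1) * (m + 1)" if "a \<le> n" "b \<le> m" for a b m n :: nat
  proof -
    have "a * (m + 1) + b < (a + 1) * (m + 1)" using that by simp
    also have "\<dots> \<le> (n + 1) * (m + 1)" using that by (intro mult_right_mono) auto
    finally show ?thesis .
  qed
  show ?thesis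
    using assms split[of 0 "num_cells B 1" j "num_cells B 2"]
      split[of "num_cells B 1" "num_cells B 1" j "num_cells B 2"]
      split[of j "num_cells B 1" 0 "num_cells B 2"]
      split[of j "num_cells B 1" "num_cells B 2" "num_cells B 2"]
    by (cases K) (simp_all only: edge_size_def num_points_def edge_index.simps edge_tangent.simps, simp_all)
qed

text \<open>The Jacobian determinant is positive on the reference square, where all grid points lie,
  and the square root factor is nonnegative.\<close>

lemma surface_jacobian_nonneg:
  assumes "sbp_block B" and "j < edge_size B K"
  shows "0 \<le> surface_jacobian B K (grid_point B (edge_index B K j))"
proof -
  have "0 < jacobian_det B (grid_point B (edge_index B K j))"
    using assms grid_point_in_ref_square[OF assms(1) edge_index_less] by (auto simp: sbp_block_def)
  then show ?thesis by (simp add: surface_jacobian_def)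
qed

lemma edge_norm:
  assumes "sbp_block B"
  shows "edge_H B K \<in> carrier_mat (edge_size B K) (edge_size B K)" "diagonal_mat (edge_H B K)"
  using assms by (auto simp: sbp_block_def sbp_operator_def edge_H_def edge_size_def)

lemma edge_p_carrier: "edge_p B K t \<in> carrier_vec (edge_size B K)"
  by (simp add: edge_p_def edge_restrict_def)

lemma edge_v_carrier: "edge_v B K t \<in> carrier_vec (edge_size B K)"
  unfolding edge_v_def edge_n_def edge_restrict_def
  by (intro add_carrier_vec mult_mat_vec_carrier[OF mat_diag_dim] vec_carrier)

lemma mass_matrix_carrier: "mass_matrix \<psi>s a b \<in> carrier_mat (length \<psi>s) (length \<psi>s)"
  by (simp add: mass_matrix_def)

lemma mass_matrix_sym: "transpose_mat (mass_matrix \<psi>s a b) = mass_matrix \<psi>s a b"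
  by (rule eq_matI) (auto simp: mass_matrix_def mult.commute)

text \<open>\<open>diag_pair_blend\<close> splits both starred pairings into an edge pairing of
  \<open>v\<close> with \<open>p\<close> and pairings with interpolated glue data. The former
  cancel, and \<open>edge_to_glue\<close> turns the latter into pairings with the block mass matrix.
  The two half-weighted corrections merge because that matrix is symmetric. The increments
  \<open>ap\<close> and \<open>av\<close> are arbitrary glue vectors here.\<close>

lemma block_dissipation:
  assumes I: "interface I" and k: "k \<in> {1..num_blocks I s}"
    and ap: "ap \<in> carrier_vec (length (block_portion I s k))"
    and av: "av \<in> carrier_vec (length (block_portion I s k))"
    and p: "if_pstar I s k t - if_p I s k t =
        if_scale I s k (-1/2) *\<^sub>v (P_g2f I s k *\<^sub>v ap)
        + (1/2) \<cdot>\<^sub>v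
          (if_scale I s k (-1/2) *\<^sub>v (P_g2f I s k *\<^sub>v block_pbar I s k t) - if_p I s k t)"
    and v: "if_vstar I s k t - if_v I s k t =
        if_scale I s k (-1/2) *\<^sub>v (P_g2f I s k *\<^sub>v av)
        + (1/2) \<cdot>\<^sub>v
          (if_scale I s k (-1/2) *\<^sub>v (P_g2f I s k *\<^sub>v block_vbar I s k t) - if_v I s k t)"
  shows "edge_dissipation (block I s k) (block_edge I s k) t =
    - (block_vbar I s k t \<bullet> (block_mass I s k *\<^sub>v ap))
    - block_pbar I s k t \<bullet> (block_mass I s k *\<^sub>v av)
    - block_vbar I s k t \<bullet> (block_mass I s k *\<^sub>v block_pbar I s k t)"
proof -
  define n where "n = if_size I s k"
  define m where "m = length (block_portion I s k)"
  define H where "H = if_H I s k"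
  define \<sigma> where "\<sigma> j = surface_jacobian (block I s k) (block_edge I s k)
    (grid_point (block I s k) (edge_index (block I s k) (block_edge I s k) j))" for j
  define d where "d = half_width I s k"
  define M where "M = block_mass I s k"
  define X where "X u w = u \<bullet> (H *\<^sub>v (mat_diag n \<sigma> *\<^sub>v w))" for u w
  define W where "W a = if_scale I s k (-1/2) *\<^sub>v (P_g2f I s k *\<^sub>v a)" for a
  have block: "sbp_block (block I s k)"
    and Pf: "P_f2g I s k \<in> carrier_mat m n" and Pg: "P_g2f I s k \<in> carrier_mat n m"
    and compat: "d \<cdot>\<^sub>m (transpose_mat (P_g2f I s k) * H) = M * P_f2g I s k"
    using I k by (auto simp: interface_def n_def m_def H_def d_def M_def)
  have H: "H \<in> carrier_mat n n" "diagonal_mat H"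
    using edge_norm[OF block] by (auto simp: H_def if_H_def n_def if_size_def)
  have \<sigma>: "0 \<le> \<sigma> j" if "j < n" for j
    unfolding \<sigma>_def using surface_jacobian_nonneg[OF block] that by (simp add: n_def if_size_def)
  have "\<forall>l<num_blocks I s. end_point I s l < end_point I s (l + 1)"
    using I by (simp add: interface_def)
  moreover have "k - 1 < num_blocks I s" "k - 1 + 1 = k" using k by auto
  ultimately have "end_point I s (k - 1) < end_point I s k" by metis
  then have d: "0 < d" by (simp add: d_def half_width_def)
  have M: "M \<in> carrier_mat m m" "transpose_mat M = M"
    unfolding M_def block_mass_def m_def by (rule mass_matrix_carrier mass_matrix_sym)+
  have SJ: "edge_SJ (block I s k) (block_edge I s k) = mat_diag n \<sigma>"
    by (simp add: edge_SJ_def n_def if_size_def \<sigma>_def[abs_def])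
  have scale: "if_scale I s k r = diag_powr ((1 / d) \<cdot>\<^sub>m mat_diag n \<sigma>) r" for r
    by (simp add: if_scale_def SJ d_def)
  have ifp: "if_p I s k t \<in> carrier_vec n" and ifv: "if_v I s k t \<in> carrier_vec n"
    by (simp_all add: if_p_def if_v_def n_def if_size_def edge_p_carrier edge_v_carrier)
  have ps: "if_pstar I s k t \<in> carrier_vec n" and vs: "if_vstar I s k t \<in> carrier_vec n"
    using block by (auto simp: sbp_block_def if_pstar_def if_vstar_def n_def if_size_def)
  have Wc: "W a \<in> carrier_vec n" for a
    unfolding W_def scale diag_scale_eq by (rule carrier_vecI) (simp add: mat_diag_def)
  have pb: "block_pbar I s k t \<in> carrier_vec m" and vb: "block_vbar I s k t \<in> carrier_vec m"
    using Pf by (auto simp: block_pbar_def block_vbar_def intro!: carrier_vecI)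
  have glue_p: "X (if_p I s k t) (W a) = block_pbar I s k t \<bullet> (M *\<^sub>v a)" if "a \<in> carrier_vec m" for a
    unfolding X_def W_def scale block_pbar_def
    using edge_to_glue[OF H \<sigma> d Pf Pg M compat ifp that] by simp
  have glue_v: "X (if_v I s k t) (W a) = block_vbar I s k t \<bullet> (M *\<^sub>v a)" if "a \<in> carrier_vec m" for a
    unfolding X_def W_def scale block_vbar_def
    using edge_to_glue[OF H \<sigma> d Pf Pg M compat ifv that] by simp
  have "X (if_v I s k t) (if_pstar I s k t) = X (if_v I s k t) (if_p I s k t) / 2
      + X (if_v I s k t) (W ap) + X (if_v I s k t) (W (block_pbar I s k t)) / 2"
    unfolding X_def by (rule diag_pair_blend[OF H ifv ifp Wc Wc p[folded W_def] ps])
  moreover have "X (if_p I s k t) (if_vstar I s k t) = X (if_p I s k t) (if_v I s k t) / 2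
      + X (if_p I s k t) (W av) + X (if_p I s k t) (W (block_vbar I s k t)) / 2"
    unfolding X_def by (rule diag_pair_blend[OF H ifp ifv Wc Wc v[folded W_def] vs])
  moreover have "X (if_p I s k t) (if_v I s k t) = X (if_v I s k t) (if_p I s k t)"
    unfolding X_def by (rule diag_pair_sym[OF H ifp ifv])
  moreover have "X (if_vstar I s k t) (if_p I s k t) = X (if_p I s k t) (if_vstar I s k t)"
    unfolding X_def by (rule diag_pair_sym[OF H vs ifp])
  moreover have "block_pbar I s k t \<bullet> (M *\<^sub>v block_vbar I s k t) =
      block_vbar I s k t \<bullet> (M *\<^sub>v block_pbar I s k t)"
    by (rule pair_sym[OF M pb vb])
  moreover have "edge_dissipation (block I s k) (block_edge I s k) t =
      - X (if_v I s k t) (if_pstar I s k t) + X (if_v I s k t) (if_p I s k t)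
      - X (if_vstar I s k t) (if_p I s k t)"
    by (simp add: edge_dissipation_def X_def SJ[symmetric] H_def if_H_def if_v_def if_p_def
        if_pstar_def if_vstar_def)
  moreover note glue_v[OF ap[folded m_def]] glue_v[OF pb] glue_p[OF av[folded m_def]] glue_p[OF vb]
  \<comment> \<open>After the symmetry facts, the edge pairing of \<open>v\<close> with
    \<open>p\<close> has the total coefficient -1/2 + 1 - 1/2 = 0.\<close>
  ultimately show ?thesis unfolding M_def[symmetric] by linarith
qed

section \<open>The L2 inner product of glue functions and positivity of the mass matrix\<close>

text \<open>Both the global and the block mass matrices have its values as entries, over different
  intervals; naming it lets the two be compared entry by entry.\<close>

definition glue_ip :: "real \<Rightarrow> real \<Rightarrow> (real \<Rightarrow> real) \<Rightarrow> (real \<Rightarrow> real) \<Rightarrow> real" where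
  "glue_ip a b \<phi> \<psi> = (LINT \<eta>:{a..b}|lborel. \<phi> \<eta> * \<psi> \<eta>)"

text \<open>The product is dominated by the integrable sum of the squares, as
  \<open>\<bar>u * w\<bar> \<le> u\<^sup>2 + w\<^sup>2\<close>. This makes all entries of the mass
  matrix genuine integrals.\<close>

lemma set_integrable_mult_of_squares:
  fixes f g :: "'a \<Rightarrow> real"
  assumes "set_borel_measurable M A f" "set_integrable M A (\<lambda>x. (f x)\<^sup>2)"
    and "set_borel_measurable M A g" "set_integrable M A (\<lambda>x. (g x)\<^sup>2)"
  shows "set_integrable M A (\<lambda>x. f x * g x)"
  unfolding set_integrable_def
proof (rule Bochner_Integration.integrable_bound)
  show "integrable M (\<lambda>x. indicator A x *\<^sub>R (f x)\<^sup>2 + indicator A x *\<^sub>R (g x)\<^sup>2)"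
    using assms(2,4) unfolding set_integrable_def by (rule Bochner_Integration.integrable_add)
  have "(\<lambda>x. (indicator A x *\<^sub>R f x) * (indicator A x *\<^sub>R g x)) \<in> borel_measurable M"
    using assms(1,3) unfolding set_borel_measurable_def by (rule borel_measurable_times)
  also have "(\<lambda>x. (indicator A x *\<^sub>R f x) * (indicator A x *\<^sub>R g x)) =
      (\<lambda>x. indicator A x *\<^sub>R (f x * g x))"
    by (auto simp: indicator_def)
  finally show "(\<lambda>x. indicator A x *\<^sub>R (f x * g x)) \<in> borel_measurable M" .
  have "\<bar>u * w\<bar> \<le> u\<^sup>2 + w\<^sup>2" for u w :: real
  proof -
    have "2 * (\<bar>u\<bar> * \<bar>w\<bar>) \<le> u\<^sup>2 + w\<^sup>2"
      using sum_squares_bound[of "\<bar>u\<bar>" "\<bar>w\<bar>"] by simp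
    moreover have "0 \<le> \<bar>u\<bar> * \<bar>w\<bar>" by simp
    ultimately show ?thesis unfolding abs_mult by linarith
  qed
  then show "AE x in M. norm (indicator A x *\<^sub>R (f x * g x)) \<le>
      norm (indicator A x *\<^sub>R (f x)\<^sup>2 + indicator A x *\<^sub>R (g x)\<^sup>2)"
    by (intro AE_I2) (auto simp: indicator_def)
qed

text \<open>The quadratic form is the integral over [-1,1] of the square of the glue function with
  coefficient vector \<open>x\<close>.\<close>

lemma glue_mass_nonneg:
  assumes G: "glue_grid G" and x: "x \<in> carrier_vec (length (glue_basis G))"
  shows "0 \<le> x \<bullet> (glue_mass G *\<^sub>v x)"
proof -
  let ?N = "length (glue_basis G)" and ?\<psi> = "\<lambda>i. glue_basis G ! i"
  let ?S = "{-1..1::real}"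
  have int: "set_integrable lborel ?S (\<lambda>\<eta>. ?\<psi> i \<eta> * ?\<psi> j \<eta>)" if "i < ?N" "j < ?N" for i j
    using G that by (intro set_integrable_mult_of_squares) (auto simp: glue_grid_def)
  \<comment> \<open>With the indicator and the coefficients built in, the set integrals become plain
    integrals, which may be interchanged with the finite sums.\<close>
  define h where "h i j \<eta> = indicator ?S \<eta> *\<^sub>R (x $ i * x $ j * (?\<psi> i \<eta> * ?\<psi> j \<eta>))" for i j \<eta>
  have int_h: "integrable lborel (h i j)" if "i < ?N" "j < ?N" for i j
    using set_integrable_mult_right[of "x $ i * x $ j" lborel ?S "\<lambda>\<eta>. ?\<psi> i \<eta> * ?\<psi> j \<eta>"]
      int[OF that]
    unfolding set_integrable_def h_def[abs_def] by blast
  have "x \<bullet> (glue_mass G *\<^sub>v x) =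
      (\<Sum>i<?N. \<Sum>j<?N. x $ i * (LINT \<eta>:?S|lborel. ?\<psi> i \<eta> * ?\<psi> j \<eta>) * x $ j)"
    using x by (subst scalar_prod_mat_eq_sum[of _ ?N ?N]) (auto simp: glue_mass_def mass_matrix_def)
  also have "\<dots> = (\<Sum>i<?N. \<Sum>j<?N. (LINT \<eta>:?S|lborel. x $ i * x $ j * (?\<psi> i \<eta> * ?\<psi> j \<eta>)))"
    by (intro sum.cong refl) (simp add: mult_ac)
  also have "\<dots> = (\<Sum>i<?N. \<Sum>j<?N. (LINT \<eta>|lborel. h i j \<eta>))"
    unfolding set_lebesgue_integral_def h_def ..
  also have "\<dots> = (\<Sum>i<?N. (LINT \<eta>|lborel. (\<Sum>j<?N. h i j \<eta>)))"
    using int_h by (intro sum.cong refl Bochner_Integration.integral_sum[symmetric]) auto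
  also have "\<dots> = (LINT \<eta>|lborel. (\<Sum>i<?N. \<Sum>j<?N. h i j \<eta>))"
    using int_h
    by (intro Bochner_Integration.integral_sum[symmetric] Bochner_Integration.integrable_sum) auto
  also have "\<dots> = (LINT \<eta>|lborel. indicator ?S \<eta> *\<^sub>R (\<Sum>i<?N. x $ i * ?\<psi> i \<eta>)\<^sup>2)"
    unfolding h_def power2_eq_square sum_product scaleR_sum_right by (simp only: mult_ac)
  also have "0 \<le> \<dots>" by (intro Bochner_Integration.integral_nonneg) simp
  finally show ?thesis .
qed

text \<open>Intervals in this position share at most one point, which is a null set.\<close>

lemma glue_ip_disjoint:
  assumes "\<And>\<eta>. \<phi> \<eta> \<noteq> 0 \<Longrightarrow> \<eta> \<in> {a..b}" and "\<And>\<eta>. \<psi> \<eta> \<noteq> 0 \<Longrightarrow> \<eta> \<in> {c..d}"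
    and "b \<le> c \<or> d \<le> a"
  shows "glue_ip u w \<phi> \<psi> = 0"
proof -
  define e where "e = (if b \<le> c then b else a)"
  have "\<phi> \<eta> * \<psi> \<eta> = 0" if "\<eta> \<noteq> e" for \<eta>
    using assms(1)[of \<eta>] assms(2)[of \<eta>] assms(3) that
    by (cases "\<phi> \<eta> = 0") (auto simp: e_def split: if_splits)
  then have "AE \<eta> in lborel. indicator {u..w} \<eta> *\<^sub>R (\<phi> \<eta> * \<psi> \<eta>) = 0"
    using AE_lborel_singleton[of e] by (auto elim!: eventually_mono)
  then show ?thesis
    unfolding glue_ip_def set_lebesgue_integral_def by (rule integral_eq_zero_AE)
qed

lemma glue_ip_restrict:
  assumes "\<And>\<eta>. \<phi> \<eta> \<noteq> 0 \<Longrightarrow> \<eta> \<in> {a..b}" and "{a..b} \<subseteq> {u..w}"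
  shows "glue_ip u w \<phi> \<psi> = glue_ip a b \<phi> \<psi>"
  unfolding glue_ip_def set_lebesgue_integral_def
proof (intro Bochner_Integration.integral_cong refl)
  fix \<eta>
  show "indicator {u..w} \<eta> *\<^sub>R (\<phi> \<eta> * \<psi> \<eta>) = indicator {a..b} \<eta> *\<^sub>R (\<phi> \<eta> * \<psi> \<eta>)"
    using assms(1)[of \<eta>] assms(2) by (cases "\<phi> \<eta> = 0") (auto simp: indicator_def)
qed

text \<open>Such a function vanishes almost everywhere, so the coefficient vector that is 1 at its
  position and 0 elsewhere would contradict linear independence modulo null sets.\<close>

lemma glue_basis_not_null:
  assumes "glue_grid G" and "\<psi> \<in> set (glue_basis G)" and "\<And>\<eta>. \<psi> \<eta> \<noteq> 0 \<Longrightarrow> \<eta> = e"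
  shows False
proof -
  let ?N = "length (glue_basis G)"
  obtain j where j: "j < ?N" "\<psi> = glue_basis G ! j"
    using assms(2) by (auto simp: in_set_conv_nth)
  define a where "a i = (if i = j then 1 else 0 :: real)" for i
  have "(\<Sum>i<?N. a i * (glue_basis G ! i) \<eta>) = (\<Sum>i<?N. if i = j then \<psi> \<eta> else 0)" for \<eta>
    by (intro sum.cong refl) (simp add: a_def j)
  then have "(\<Sum>i<?N. a i * (glue_basis G ! i) \<eta>) = \<psi> \<eta>" for \<eta>
    using j by simp
  moreover have "AE \<eta> in lborel. \<psi> \<eta> = 0"
    using AE_lborel_singleton[of e] assms(3) by (auto elim!: eventually_mono)
  ultimately have "AE \<eta> in lborel. \<eta> \<in> {-1..1} \<longrightarrow> (\<Sum>i<?N. a i * (glue_basis G ! i) \<eta>) = 0"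
    by (auto elim!: eventually_mono)
  then have "\<forall>i<?N. a i = 0"
    using assms(1) unfolding glue_grid_def by blast
  then show False using j by (auto simp: a_def)
qed

section \<open>Partition of the glue basis into block portions\<close>

lemma partition_mono:
  fixes \<beta> :: "nat \<Rightarrow> real"
  assumes "\<forall>k<n. \<beta> k < \<beta> (k + 1)" and "i \<le> j" and "j \<le> n"
  shows "\<beta> i \<le> \<beta> j"
  using assms(2,3)
proof (induction j)
  case (Suc j)
  show ?case
  proof (cases "i = Suc j")
    case False
    then have "\<beta> i \<le> \<beta> j" using Suc by simp
    also have "\<beta> j < \<beta> (Suc j)" using assms(1) Suc.prems(2) by simp
    finally show ?thesis by simp
  qed simp
qed simp

lemma glue_portion_support:
  assumes "\<psi> \<in> set (glue_portion G a b)" and "\<psi> \<eta> \<noteq> 0"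
  shows "\<eta> \<in> {a..b}"
  using assms unfolding glue_portion_def set_filter by blast

text \<open>Block end points are glue nodes, so every glue interval lies inside some block, and the
  ordering of the basis by glue intervals is also an ordering by blocks. A function fitting two
  blocks would be supported at a single point, which \<open>glue_basis_not_null\<close> excludes;
  hence no function is listed twice.\<close>

lemma concat_glue_portions:
  fixes \<beta> :: "nat \<Rightarrow> real"
  assumes G: "glue_grid G" and \<beta>0: "\<beta> 0 = -1" and \<beta>n: "\<beta> n = 1"
    and inc: "\<forall>k<n. \<beta> k < \<beta> (k + 1)"
    and nodes: "\<forall>k\<le>n. \<beta> k \<in> set (glue_nodes G)"
  shows "concat (map (\<lambda>k. glue_portion G (\<beta> (k - 1)) (\<beta> k)) [1..<Suc n]) = glue_basis G"
proof -
  let ?xs = "glue_nodes G" and ?\<psi>s = "glue_basis G"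
  define supp where "supp k \<psi> \<longleftrightarrow> (\<forall>\<eta>. \<psi> \<eta> \<noteq> 0 \<longrightarrow> \<eta> \<in> {\<beta> (k - 1)..\<beta> k})"
    for k and \<psi> :: "real \<Rightarrow> real"
  obtain c where c: "\<And>j. j < length ?\<psi>s \<Longrightarrow> c j + 1 < length ?xs"
      "\<And>j \<eta>. j < length ?\<psi>s \<Longrightarrow> (?\<psi>s ! j) \<eta> \<noteq> 0 \<Longrightarrow> \<eta> \<in> {?xs ! c j..?xs ! (c j + 1)}"
      "\<And>i j. i \<le> j \<Longrightarrow> j < length ?\<psi>s \<Longrightarrow> c i \<le> (c j :: nat)"
    using G unfolding glue_grid_def by blast
  have len: "2 \<le> length ?xs" and srt: "sorted_wrt (<) ?xs"
    and hd: "hd ?xs = -1" and lst: "last ?xs = 1"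
    using G by (auto simp: glue_grid_def)
  have xs_less: "?xs ! i < ?xs ! j \<longleftrightarrow> i < j" if "i < length ?xs" "j < length ?xs" for i j
    using sorted_wrt_nth_less[OF srt, of i j] sorted_wrt_nth_less[OF srt, of j i] that
    by (cases i j rule: linorder_cases) auto
  have x0: "?xs ! 0 = -1" using hd len by (cases ?xs) auto
  have xlast: "?xs ! (length ?xs - 1) = 1" using lst len by (subst last_conv_nth[symmetric]) auto
  define cell where "cell j k \<longleftrightarrow> k \<in> {1..n} \<and> \<beta> (k - 1) \<le> ?xs ! c j \<and> ?xs ! (c j + 1) \<le> \<beta> k"
    for j k
  have ex: "\<exists>k. cell j k" if j: "j < length ?\<psi>s" for j
  proof -
    let ?P = "\<lambda>k. k \<le> n \<and> ?xs ! (c j + 1) \<le> \<beta> k"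
    \<comment> \<open>The first block whose right end reaches the right end of the glue interval. It
      exists because \<open>\<beta> n\<close> is the last node, and it is not 0 because
      \<open>\<beta> 0\<close> is the first. By minimality the left end of this block is a node
      strictly before the right end of the glue interval, hence no later than its left end.\<close>
    define k where "k = (LEAST k. ?P k)"
    have "?xs ! (c j + 1) \<le> ?xs ! (length ?xs - 1)"
      using xs_less[of "length ?xs - 1" "c j + 1"] c(1)[OF j] by force
    then have "?P n" using \<beta>n xlast by simp
    then have k: "?P k" unfolding k_def by (rule LeastI)
    have "0 < length ?xs" using len by linarith
    from xs_less[OF this c(1)[OF j]] have "?xs ! 0 < ?xs ! (c j + 1)" by simp
    then have "k \<noteq> 0" using k x0 \<beta>0 by (metis not_le)
    then have "\<not> ?P (k - 1)" unfolding k_def by (intro not_less_Least) (simp add: k_def[symmetric])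
    then have less: "\<beta> (k - 1) < ?xs ! (c j + 1)" using k by auto
    have "k - 1 \<le> n" using k by linarith
    then have "\<beta> (k - 1) \<in> set ?xs" using nodes by blast
    then obtain m where m: "m < length ?xs" "\<beta> (k - 1) = ?xs ! m"
      by (metis in_set_conv_nth)
    then have "m \<le> c j" using less xs_less[of m "c j + 1"] c(1)[OF j] by simp
    then have "\<beta> (k - 1) \<le> ?xs ! c j" using m xs_less[of "c j" m] c(1)[OF j] by force
    then have "cell j k" using k \<open>k \<noteq> 0\<close> unfolding cell_def by simp
    then show ?thesis ..
  qed
  define \<kappa>' where "\<kappa>' j = (SOME k. cell j k)" for j
  have \<kappa>': "cell j (\<kappa>' j)" if "j < length ?\<psi>s" for j
    unfolding \<kappa>'_def using ex[OF that] by (rule someI_ex)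
  have supp_unique: "k = l" if "k \<in> {1..n}" "l \<in> {1..n}" "supp k \<psi>" "supp l \<psi>" "\<psi> \<in> set ?\<psi>s"
    for k l \<psi>
  proof -
    have "\<not> k' < l'" if "k' \<in> {1..n}" "l' \<in> {1..n}" "supp k' \<psi>" "supp l' \<psi>" for k' l'
    proof
      assume "k' < l'"
      \<comment> \<open>A function supported in both blocks can then be nonzero only at
        \<open>\<beta> k'\<close>.\<close>
      then have "\<beta> k' \<le> \<beta> (l' - 1)" using that by (intro partition_mono[OF inc]) auto
      then have "\<psi> \<eta> \<noteq> 0 \<Longrightarrow> \<eta> = \<beta> k'" for \<eta>
        using that(3,4) unfolding supp_def by force
      then show False using glue_basis_not_null[OF G \<open>\<psi> \<in> set ?\<psi>s\<close>] by blast
    qed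
    from this[of k l] this[of l k] that show ?thesis by (metis linorder_cases)
  qed
  have supp_\<kappa>': "supp (\<kappa>' j) (?\<psi>s ! j)" if "j < length ?\<psi>s" for j
    using \<kappa>'[OF that] c(2)[OF that] unfolding supp_def cell_def by force
  \<comment> \<open>\<open>sorted_concat_filter\<close> needs a key on the functions themselves
    rather than on their positions. Uniqueness of the supporting block makes \<open>\<kappa>\<close>
    well defined and equal to \<open>\<kappa>'\<close> at each position.\<close>
  define \<kappa> where "\<kappa> \<psi> = (THE k. k \<in> {1..n} \<and> supp k \<psi>)" for \<psi>
  have \<kappa>_eq: "\<kappa> \<psi> = k" if "k \<in> {1..n}" "supp k \<psi>" "\<psi> \<in> set ?\<psi>s" for k \<psi>
    unfolding \<kappa>_def using that supp_unique by (intro the_equality) auto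
  have \<kappa>_nth: "\<kappa> (?\<psi>s ! j) = \<kappa>' j" if "j < length ?\<psi>s" for j
    using \<kappa>'[OF that] supp_\<kappa>'[OF that] that by (intro \<kappa>_eq) (auto simp: cell_def)
  have \<kappa>_props: "\<kappa> \<psi> \<in> {1..n} \<and> supp (\<kappa> \<psi>) \<psi>" if "\<psi> \<in> set ?\<psi>s" for \<psi>
  proof -
    obtain j where "j < length ?\<psi>s" "\<psi> = ?\<psi>s ! j" using \<open>\<psi> \<in> set ?\<psi>s\<close> by (auto simp: in_set_conv_nth)
    then show ?thesis using \<kappa>_nth \<kappa>'[of j] supp_\<kappa>'[of j] by (simp add: cell_def)
  qed
  have "\<kappa>' i \<le> \<kappa>' j" if ij: "i \<le> j" "j < length ?\<psi>s" for i j
  proof (rule ccontr)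
    assume "\<not> \<kappa>' i \<le> \<kappa>' j"
    \<comment> \<open>If the earlier function belonged to a later block, its glue interval would
      start at or after the end of the interval of the later function, contrary to
      \<open>c i \<le> c j\<close>.\<close>
    then have "\<beta> (\<kappa>' j) \<le> \<beta> (\<kappa>' i - 1)"
      using \<kappa>'[of i] ij by (intro partition_mono[OF inc]) (auto simp: cell_def)
    moreover have "\<beta> (\<kappa>' i - 1) \<le> ?xs ! c i" "?xs ! (c j + 1) \<le> \<beta> (\<kappa>' j)"
      using \<kappa>'[of i] \<kappa>'[of j] ij by (auto simp: cell_def)
    moreover have "?xs ! c i < ?xs ! (c j + 1)"
      using xs_less[of "c i" "c j + 1"] c(3)[OF ij] c(1)[of j] ij by auto
    ultimately show False by linarith
  qed
  then have "sorted (map \<kappa> ?\<psi>s)"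
    unfolding sorted_iff_nth_mono by (auto simp: \<kappa>_nth)
  then have "concat (map (\<lambda>k. filter (\<lambda>\<psi>. \<kappa> \<psi> = k) ?\<psi>s) [1..<Suc n]) = ?\<psi>s"
    using \<kappa>_props by (intro sorted_concat_filter) auto
  moreover have "map (\<lambda>k. filter (\<lambda>\<psi>. \<kappa> \<psi> = k) ?\<psi>s) [1..<Suc n] =
      map (\<lambda>k. glue_portion G (\<beta> (k - 1)) (\<beta> k)) [1..<Suc n]"
  proof (rule map_cong[OF refl])
    fix k assume "k \<in> set [1..<Suc n]"
    then have k: "k \<in> {1..n}" by auto
    have "filter (\<lambda>\<psi>. \<kappa> \<psi> = k) ?\<psi>s = filter (supp k) ?\<psi>s"
      using \<kappa>_eq[OF k] \<kappa>_props by (intro filter_cong refl) auto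
    then show "filter (\<lambda>\<psi>. \<kappa> \<psi> = k) ?\<psi>s = glue_portion G (\<beta> (k - 1)) (\<beta> k)"
      by (simp add: glue_portion_def supp_def[abs_def])
  qed
  ultimately show ?thesis by (simp only:)
qed

section \<open>Block diagonality of the mass matrix for either side\<close>

lemma interface_glue_grid: "interface I \<Longrightarrow> glue_grid (glue I)"
  by (simp add: interface_def)

lemma interface_partition:
  assumes "interface I"
  shows "end_point I s 0 = -1" "end_point I s (num_blocks I s) = 1"
    "\<forall>k<num_blocks I s. end_point I s k < end_point I s (k + 1)"
    "\<forall>k\<le>num_blocks I s. end_point I s k \<in> set (glue_nodes (glue I))"
  using assms by (auto simp: interface_def)

lemma concat_block_portions:
  assumes "interface I"
  shows "concat (map (block_portion I s) [1..<Suc (num_blocks I s)]) = glue_basis (glue I)"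
  unfolding block_portion_def[abs_def] by (rule concat_glue_portions[OF interface_glue_grid[OF assms] interface_partition[OF assms]])

lemma length_glue_basis:
  assumes "interface I"
  shows "length (glue_basis (glue I)) = (\<Sum>l = 1..<Suc (num_blocks I s). length (block_portion I s l))"
  unfolding concat_block_portions[OF assms, of s, symmetric] by (rule length_concat_upt)

text \<open>Entries between different blocks vanish because the supports overlap in at most a point,
  and within a block the integral over [-1,1] reduces to the block interval. As the side
  \<open>s\<close> is arbitrary, the block sums of both sides represent one and the same
  form.\<close>

lemma glue_mass_block_sum:
  assumes I: "interface I"
    and x: "x \<in> carrier_vec (length (glue_basis (glue I)))"
    and y: "y \<in> carrier_vec (length (glue_basis (glue I)))"
  shows "x \<bullet> (glue_mass (glue I) *\<^sub>v y) =
    (\<Sum>k = 1..num_blocks I s. portion I s k x \<bullet> (block_mass I s k *\<^sub>v portion I s k y))"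
proof -
  let ?n = "num_blocks I s" and ?\<psi> = "\<lambda>i. glue_basis (glue I) ! i" and ?L = "block_portion I s"
  let ?N = "length (glue_basis (glue I))" and ?\<beta> = "end_point I s"
  define ofs where "ofs k = (\<Sum>l = 1..<k. length (?L l))" for k
  note part = interface_partition[OF I, of s]
  have supp: "\<eta> \<in> {?\<beta> (k - 1)..?\<beta> k}" if "i < length (?L k)" "(?L k ! i) \<eta> \<noteq> 0" for k i \<eta>
    using glue_portion_support[OF nth_mem[OF that(1), unfolded block_portion_def[of I s k]]
        that(2)[unfolded block_portion_def[of I s k]]] .
  have nth: "?\<psi> (ofs k + i) = ?L k ! i" if "k \<in> {1..?n}" "i < length (?L k)" for k i
    using concat_upt_nth[of k ?n i ?L] that unfolding ofs_def concat_block_portions[OF I] .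
  have sums: "(\<Sum>j<?N. f j) = (\<Sum>k = 1..?n. \<Sum>i<length (?L k). f (ofs k + i))" for f :: "nat \<Rightarrow> real"
    unfolding length_glue_basis[OF I, of s] ofs_def by (rule sum_offsets)
  have off: "glue_ip (-1) 1 (?L k ! i) (?L l ! j) = 0"
    if "k \<in> {1..?n}" "l \<in> {1..?n}" "k \<noteq> l" "i < length (?L k)" "j < length (?L l)" for k l i j
  proof (rule glue_ip_disjoint[OF supp[OF that(4)] supp[OF that(5)]])
    show "?\<beta> k \<le> ?\<beta> (l - 1) \<or> ?\<beta> l \<le> ?\<beta> (k - 1)"
    proof (cases "k < l")
      case True
      then have "?\<beta> k \<le> ?\<beta> (l - 1)" using that by (intro partition_mono[OF part(3)]) auto
      then show ?thesis ..
    next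
      case False
      then have "?\<beta> l \<le> ?\<beta> (k - 1)" using that by (intro partition_mono[OF part(3)]) auto
      then show ?thesis ..
    qed
  qed
  have diag: "glue_ip (-1) 1 (?L k ! i) \<phi> = glue_ip (?\<beta> (k - 1)) (?\<beta> k) (?L k ! i) \<phi>"
    if "k \<in> {1..?n}" "i < length (?L k)" for k i \<phi>
  proof (rule glue_ip_restrict[OF supp[OF that(2)]])
    have "?\<beta> 0 \<le> ?\<beta> (k - 1)" "?\<beta> k \<le> ?\<beta> ?n"
      using that by (auto intro!: partition_mono[OF part(3)])
    then show "{?\<beta> (k - 1)..?\<beta> k} \<subseteq> {-1..1}" using part(1,2) by auto
  qed
  have "x \<bullet> (glue_mass (glue I) *\<^sub>v y) =
      (\<Sum>i<?N. \<Sum>j<?N. x $ i * glue_ip (-1) 1 (?\<psi> i) (?\<psi> j) * y $ j)"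
    using x y
    by (subst scalar_prod_mat_eq_sum[of _ ?N ?N]) (auto simp: glue_mass_def mass_matrix_def glue_ip_def)
  also have "\<dots> = (\<Sum>k = 1..?n. \<Sum>i<length (?L k). \<Sum>l = 1..?n. \<Sum>j<length (?L l).
      x $ (ofs k + i) * glue_ip (-1) 1 (?\<psi> (ofs k + i)) (?\<psi> (ofs l + j)) * y $ (ofs l + j))"
    unfolding sums ..
  also have "\<dots> = (\<Sum>k = 1..?n. \<Sum>i<length (?L k). \<Sum>j<length (?L k).
      x $ (ofs k + i) * glue_ip (?\<beta> (k - 1)) (?\<beta> k) (?L k ! i) (?L k ! j) * y $ (ofs k + j))"
  proof (rule sum.cong[OF refl], rule sum.cong[OF refl])
    fix k i assume k: "k \<in> {1..?n}" and i: "i \<in> {..<length (?L k)}"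
    let ?s = "\<Sum>j<length (?L k).
      x $ (ofs k + i) * glue_ip (?\<beta> (k - 1)) (?\<beta> k) (?L k ! i) (?L k ! j) * y $ (ofs k + j)"
    \<comment> \<open>For a fixed row in block \<open>k\<close> only the columns of the same block
      contribute.\<close>
    have "(\<Sum>l = 1..?n. \<Sum>j<length (?L l).
        x $ (ofs k + i) * glue_ip (-1) 1 (?\<psi> (ofs k + i)) (?\<psi> (ofs l + j)) * y $ (ofs l + j)) =
      (\<Sum>l = 1..?n. if l = k then ?s else 0)"
    proof (intro sum.cong refl)
      fix l assume l: "l \<in> {1..?n}"
      show "(\<Sum>j<length (?L l).
          x $ (ofs k + i) * glue_ip (-1) 1 (?\<psi> (ofs k + i)) (?\<psi> (ofs l + j)) * y $ (ofs l + j)) =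
        (if l = k then ?s else 0)"
      proof (cases "l = k")
        case True
        then show ?thesis using k i by (simp add: nth diag)
      next
        case False
        then show ?thesis using k i l by (simp add: nth off)
      qed
    qed
    also have "\<dots> = ?s" using k by simp
    finally show "(\<Sum>l = 1..?n. \<Sum>j<length (?L l).
        x $ (ofs k + i) * glue_ip (-1) 1 (?\<psi> (ofs k + i)) (?\<psi> (ofs l + j)) * y $ (ofs l + j)) = ?s" .
  qed
  also have "\<dots> = (\<Sum>k = 1..?n. portion I s k x \<bullet> (block_mass I s k *\<^sub>v portion I s k y))"
  proof (intro sum.cong refl)
    fix k
    show "(\<Sum>i<length (?L k). \<Sum>j<length (?L k).
        x $ (ofs k + i) * glue_ip (?\<beta> (k - 1)) (?\<beta> k) (?L k ! i) (?L k ! j) * y $ (ofs k + j)) =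
      portion I s k x \<bullet> (block_mass I s k *\<^sub>v portion I s k y)"
      by (subst scalar_prod_mat_eq_sum[of _ "length (?L k)" "length (?L k)"])
        (auto simp: block_mass_def mass_matrix_def glue_ip_def portion_def ofs_def)
  qed
  finally show ?thesis .
qed

section \<open>Stacked glue vectors and the dissipation of one side\<close>

lemma portion_carrier: "portion I s k w \<in> carrier_vec (length (block_portion I s k))"
  by (simp add: portion_def)

lemma portion_minus:
  assumes I: "interface I" and k: "k \<in> {1..num_blocks I s}"
    and "u \<in> carrier_vec (length (glue_basis (glue I)))"
    and "w \<in> carrier_vec (length (glue_basis (glue I)))"
  shows "portion I s k (u - w) = portion I s k u - portion I s k w"
proof (rule eq_vecI)
  fix i assume "i < dim_vec (portion I s k u - portion I s k w)"
  then have i: "i < length (block_portion I s k)" by (simp add: portion_def)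
  \<comment> \<open>The entrywise rule for vector subtraction applies only below the dimension, so
    the shifted index has to be bounded.\<close>
  then have "(\<Sum>l = 1..<k. length (block_portion I s l)) + i < length (glue_basis (glue I))"
    unfolding length_glue_basis[OF I, of s] using k by (intro offset_add_less) auto
  then show "portion I s k (u - w) $ i = (portion I s k u - portion I s k w) $ i"
    using assms(3,4) i by (simp add: portion_def)
qed (simp add: portion_def)

lemma portion_stack:
  assumes I: "interface I" and k: "k \<in> {1..num_blocks I s}"
    and u: "\<And>l. l \<in> {1..num_blocks I s} \<Longrightarrow> dim_vec (u l) = length (block_portion I s l)"
  shows "portion I s k (stack (map u [1..<Suc (num_blocks I s)])) = u k"
proof (rule eq_vecI)
  fix i assume i: "i < dim_vec (u k)"
  have "(\<Sum>l = 1..<k. length (block_portion I s l)) = (\<Sum>l = 1..<k. dim_vec (u l))"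
    using k by (intro sum.cong refl u[symmetric]) auto
  then show "portion I s k (stack (map u [1..<Suc (num_blocks I s)])) $ i = u k $ i"
    using stack_upt_nth[of k "num_blocks I s" i u] k i u[OF k] by (simp add: portion_def del: upt_Suc)
qed (use u[OF k] in \<open>simp add: portion_def\<close>)

lemma stack_carrier:
  assumes I: "interface I"
    and u: "\<And>l. l \<in> {1..num_blocks I s} \<Longrightarrow> dim_vec (u l) = length (block_portion I s l)"
  shows "stack (map u [1..<Suc (num_blocks I s)]) \<in> carrier_vec (length (glue_basis (glue I)))"
  unfolding length_glue_basis[OF I, of s]
  by (rule carrier_vecI, unfold dim_stack_upt) (intro sum.cong refl u, auto)

lemma block_bar_dim:
  assumes "interface I" and "k \<in> {1..num_blocks I s}"
  shows "dim_vec (block_pbar I s k t) = length (block_portion I s k)"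
    "dim_vec (block_vbar I s k t) = length (block_portion I s k)"
proof -
  have "P_f2g I s k \<in> carrier_mat (length (block_portion I s k)) (if_size I s k)"
    using assms unfolding interface_def by blast
  then show "dim_vec (block_pbar I s k t) = length (block_portion I s k)"
    "dim_vec (block_vbar I s k t) = length (block_portion I s k)"
    by (auto simp: block_pbar_def block_vbar_def)
qed

lemma portion_bar:
  assumes "interface I" and "k \<in> {1..num_blocks I s}"
  shows "portion I s k (pbar I s t) = block_pbar I s k t"
    "portion I s k (vbar I s t) = block_vbar I s k t"
  unfolding pbar_def vbar_def Suc_eq_plus1[symmetric]
  by (rule portion_stack[OF assms], erule block_bar_dim[OF assms(1)])+

lemma bar_carrier:
  assumes "interface I"
  shows "pbar I s t \<in> carrier_vec (length (glue_basis (glue I)))"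
    "vbar I s t \<in> carrier_vec (length (glue_basis (glue I)))"
  unfolding pbar_def vbar_def Suc_eq_plus1[symmetric]
  by (rule stack_carrier[OF assms], erule block_bar_dim[OF assms(1)])+

text \<open>The block contributions are summed, and \<open>glue_mass_block_sum\<close> reassembles
  them into pairings with the full mass matrix, in which the subdivision into blocks is no longer
  visible. The upwind choice of \<open>ps\<close> and \<open>vs\<close> enters only when the two
  sides are combined.\<close>

lemma dissipation_glue:
  assumes I: "interface I"
    and p: "\<And>k. k \<in> {1..num_blocks I s} \<Longrightarrow>
      if_pstar I s k t - if_p I s k t =
        if_scale I s k (-1/2) *\<^sub>v (P_g2f I s k *\<^sub>v (portion I s k ps - block_pbar I s k t))
        + (1/2) \<cdot>\<^sub>v
          (if_scale I s k (-1/2) *\<^sub>v (P_g2f I s k *\<^sub>v block_pbar I s k t) - if_p I s k t)"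
    and v: "\<And>k. k \<in> {1..num_blocks I s} \<Longrightarrow>
      if_vstar I s k t - if_v I s k t =
        if_scale I s k (-1/2) *\<^sub>v (P_g2f I s k *\<^sub>v (portion I s k vs - block_vbar I s k t))
        + (1/2) \<cdot>\<^sub>v
          (if_scale I s k (-1/2) *\<^sub>v (P_g2f I s k *\<^sub>v block_vbar I s k t) - if_v I s k t)"
    and ps: "ps \<in> carrier_vec (length (glue_basis (glue I)))"
    and vs: "vs \<in> carrier_vec (length (glue_basis (glue I)))"
  shows "dissipation I s t =
    - (vbar I s t \<bullet> (glue_mass (glue I) *\<^sub>v (ps - pbar I s t)))
    - pbar I s t \<bullet> (glue_mass (glue I) *\<^sub>v (vs - vbar I s t))
    - vbar I s t \<bullet> (glue_mass (glue I) *\<^sub>v pbar I s t)"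
proof -
  note bar = bar_carrier[OF I, of s t]
  have eq: "portion I s k (ps - pbar I s t) = portion I s k ps - block_pbar I s k t"
    "portion I s k (vs - vbar I s t) = portion I s k vs - block_vbar I s k t"
    if "k \<in> {1..num_blocks I s}" for k
    using portion_minus[OF I that] bar ps vs portion_bar[OF I that] by simp_all
  have "dissipation I s t = (\<Sum>k = 1..num_blocks I s.
      - (portion I s k (vbar I s t) \<bullet> (block_mass I s k *\<^sub>v portion I s k (ps - pbar I s t)))
      - portion I s k (pbar I s t) \<bullet> (block_mass I s k *\<^sub>v portion I s k (vs - vbar I s t))
      - portion I s k (vbar I s t) \<bullet> (block_mass I s k *\<^sub>v portion I s k (pbar I s t)))"
    unfolding dissipation_def
  proof (intro sum.cong refl)
    fix k assume k: "k \<in> {1..num_blocks I s}"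
    show "edge_dissipation (block I s k) (block_edge I s k) t =
      - (portion I s k (vbar I s t) \<bullet> (block_mass I s k *\<^sub>v portion I s k (ps - pbar I s t)))
      - portion I s k (pbar I s t) \<bullet> (block_mass I s k *\<^sub>v portion I s k (vs - vbar I s t))
      - portion I s k (vbar I s t) \<bullet> (block_mass I s k *\<^sub>v portion I s k (pbar I s t))"
      unfolding portion_bar[OF I k]
      by (rule block_dissipation[OF I k portion_carrier portion_carrier])
        (simp_all only: eq[OF k] p[OF k] v[OF k])
  qed
  then show ?thesis
    using bar ps vs
    by (simp add: glue_mass_block_sum[OF I, where s = s] sum_subtractf sum_negf)
qed

theorem theorem4p2:
  fixes \<rho> lam \<alpha> Z t :: real and T :: "real set" and I :: interface
  assumes "0 < \<rho>" and "0 < lam" and "Z = sqrt (\<rho> / lam)"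
    and "is_interval T"
    and "interface I"
    and "\<And>s k. k \<in> {1..num_blocks I s} \<Longrightarrow> semi_discretization \<rho> lam T (block I s k)"
    and "\<And>s k \<tau>. k \<in> {1..num_blocks I s} \<Longrightarrow> \<tau> \<in> T \<Longrightarrow>
      if_pstar I s k \<tau> - if_p I s k \<tau> =
        if_scale I s k (-1/2) *\<^sub>v
          (P_g2f I s k *\<^sub>v (portion I s k (pbar_star \<alpha> Z I s \<tau>) - block_pbar I s k \<tau>))
        + (1/2) \<cdot>\<^sub>v
          (if_scale I s k (-1/2) *\<^sub>v (P_g2f I s k *\<^sub>v block_pbar I s k \<tau>) - if_p I s k \<tau>)"
    and "\<And>s k \<tau>. k \<in> {1..num_blocks I s} \<Longrightarrow> \<tau> \<in> T \<Longrightarrow>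
      if_vstar I s k \<tau> - if_v I s k \<tau> =
        if_scale I s k (-1/2) *\<^sub>v
          (P_g2f I s k *\<^sub>v (portion I s k (vbar_star \<alpha> Z I s \<tau>) - block_vbar I s k \<tau>))
        + (1/2) \<cdot>\<^sub>v
          (if_scale I s k (-1/2) *\<^sub>v (P_g2f I s k *\<^sub>v block_vbar I s k \<tau>) - if_v I s k \<tau>)"
    and "t \<in> T"
  shows "dissipation I Minus t + dissipation I Plus t =
      - \<alpha> * (Z / 2) * ((vbar I Minus t + vbar I Plus t) \<bullet>
          (glue_mass (glue I) *\<^sub>v (vbar I Minus t + vbar I Plus t)))
      - \<alpha> * (1 / (2 * Z)) * ((pbar I Minus t - pbar I Plus t) \<bullet>
          (glue_mass (glue I) *\<^sub>v (pbar I Minus t - pbar I Plus t))) \<and>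
    (0 \<le> \<alpha> \<longrightarrow> dissipation I Minus t + dissipation I Plus t \<le> 0)"
proof -
  let ?M = "glue_mass (glue I)"
  define N where "N = length (glue_basis (glue I))"
  define B where "B x y = x \<bullet> (?M *\<^sub>v y)" for x y
  define p where "p s = pbar I s t" for s
  define v where "v s = vbar I s t" for s
  have M: "?M \<in> carrier_mat N N" "transpose_mat ?M = ?M"
    unfolding glue_mass_def N_def by (rule mass_matrix_carrier mass_matrix_sym)+
  have c: "p s \<in> carrier_vec N" "v s \<in> carrier_vec N" for s
    using bar_carrier[OF assms(5)] by (auto simp: p_def v_def N_def)
  have add: "B x (u + w) = B x u + B x w"
    and minus: "B x (u - w) = B x u - B x w"
    if "x \<in> carrier_vec N" "u \<in> carrier_vec N" "w \<in> carrier_vec N" for x u w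
    unfolding B_def using that by (rule pair_add[OF M(1)], rule_tac pair_minus[OF M(1)])
  have smult: "B x (r \<cdot>\<^sub>v u) = r * B x u" if "x \<in> carrier_vec N" "u \<in> carrier_vec N" for x u r
    unfolding B_def using that by (rule pair_smult[OF M(1)])
  have sym: "B x y = B y x" if "x \<in> carrier_vec N" "y \<in> carrier_vec N" for x y
    unfolding B_def using that by (rule pair_sym[OF M])
  define a where "a = \<alpha> * (Z / 2)"
  define b where "b = \<alpha> * (1 / (2 * Z))"
  \<comment> \<open>Expanding by linearity for a general side treats both sides at once; only values
    of \<open>B\<close> at the four glue vectors remain.\<close>
  have one_side: "dissipation I s t =
      - ((1/2) * (B (v s) (p (opposite s)) - B (v s) (p s))
        + a * (B (v s) (v (opposite s)) + B (v s) (v s)))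
      - ((-1/2) * (B (p s) (v (opposite s)) + B (p s) (v s))
        - b * (B (p s) (p (opposite s)) - B (p s) (p s)))
      - B (v s) (p s)" for s
  proof -
    let ?dp = "(1/2) \<cdot>\<^sub>v (p (opposite s) - p s) + a \<cdot>\<^sub>v (v (opposite s) + v s)"
    \<comment> \<open>The outer minus sign of \<open>vbar_star\<close> is moved into the scalar, so
      that the rules for sums, differences and multiples suffice.\<close>
    let ?dv = "(-1/2) \<cdot>\<^sub>v (v (opposite s) + v s) - b \<cdot>\<^sub>v (p (opposite s) - p s)"
    have ps: "pbar_star \<alpha> Z I s t = p s + ?dp"
      by (simp add: pbar_star_def p_def v_def a_def)
    have vs: "vbar_star \<alpha> Z I s t = v s + ?dv"
      using c[of s] c[of "opposite s"]
      by (intro eq_vecI) (auto simp: vbar_star_def p_def[symmetric] v_def[symmetric] b_def)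
    have "p s + ?dp - p s = ?dp" "v s + ?dv - v s = ?dv"
      using c[of s] c[of "opposite s"] by (auto intro!: eq_vecI)
    moreover have "dissipation I s t = - B (v s) (pbar_star \<alpha> Z I s t - p s)
        - B (p s) (vbar_star \<alpha> Z I s t - v s) - B (v s) (p s)"
      unfolding B_def p_def v_def
    proof (rule dissipation_glue[OF assms(5) assms(7)[OF _ assms(9)] assms(8)[OF _ assms(9)]])
      show "pbar_star \<alpha> Z I s t \<in> carrier_vec (length (glue_basis (glue I)))"
        "vbar_star \<alpha> Z I s t \<in> carrier_vec (length (glue_basis (glue I)))"
        unfolding ps vs N_def[symmetric]
        using c[of s] c[of "opposite s"] by simp_all
    qed
    ultimately show ?thesis
      using c[of s] c[of "opposite s"] by (simp add: ps vs add minus smult)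
  qed
  let ?V = "v Minus + v Plus" and ?P = "p Minus - p Plus"
  have BV: "B ?V ?V = B (v Minus) (v Minus) + 2 * B (v Minus) (v Plus) + B (v Plus) (v Plus)"
    using c by (simp add: add sym[of ?V] sym[of "v Plus" "v Minus"])
  have BP: "B ?P ?P = B (p Minus) (p Minus) - 2 * B (p Minus) (p Plus) + B (p Plus) (p Plus)"
    using c by (simp add: minus sym[of ?P] sym[of "p Plus" "p Minus"])
  have "B (v Minus) (p s) = B (p s) (v Minus)" "B (v Plus) (p s) = B (p s) (v Plus)"
    "B (v Plus) (v Minus) = B (v Minus) (v Plus)" "B (p Plus) (p Minus) = B (p Minus) (p Plus)" for s
    using c by (auto intro: sym)
  \<comment> \<open>The pairings of \<open>v\<close> with \<open>p\<close> on the same side cancel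
    with weights 1/2 + 1/2 - 1, and those across the interface cancel between the two sides. The
    remaining terms are the two completed squares.\<close>
  then have "dissipation I Minus t + dissipation I Plus t = - a * B ?V ?V - b * B ?P ?P"
    unfolding one_side opposite.simps BV BP by (simp add: algebra_simps)
  then have eq: "dissipation I Minus t + dissipation I Plus t =
      - \<alpha> * (Z / 2) * B ?V ?V - \<alpha> * (1 / (2 * Z)) * B ?P ?P"
    by (simp add: a_def b_def)
  have nonneg: "0 \<le> B ?V ?V" "0 \<le> B ?P ?P"
    unfolding B_def using c interface_glue_grid[OF assms(5)]
    by (auto intro!: glue_mass_nonneg simp: N_def[symmetric])
  have "0 < Z" using assms(1-3) by simp
  have "dissipation I Minus t + dissipation I Plus t \<le> 0" if "0 \<le> \<alpha>"
  proof -
    have "0 \<le> \<alpha> * (Z / 2) * B ?V ?V" "0 \<le> \<alpha> * (1 / (2 * Z)) * B ?P ?P"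
      using that nonneg \<open>0 < Z\<close> by (auto intro!: mult_nonneg_nonneg divide_nonneg_nonneg)
    then show ?thesis using eq by linarith
  qed
  with eq show ?thesis unfolding B_def p_def v_def by blast
qed

end
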